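(* Let $\{\xi_{\mathbf i}:\mathbf i\in\mathbb Z^q\}$ be a strictly stationary, $\varphi$-mixing random field with values in $\mathbb R^p$, with $\mathbb E(\xi_{\mathbf 0})=\mathbf 0$, $\max_{1\le j\le p}\mathbb E\big(\xi_{\mathbf 0}^{(j)}\big)^4<\infty$, and mixing coefficients satisfying $\sum_{r=1}^\infty r^{q-1}\varphi^{1/2}(r)<\infty$. Let the weights $w_{\mathbf m}(\mathbf j)$ satisfy (W1) $w_{\mathbf m}(\mathbf j)\to1$ as $\mathbf m\to\infty$ for all $\mathbf j\in\mathbb Z^q$, and (W2) $|w_{\mathbf m}(\mathbf j)|\le C_w<\infty$ for a constant $C_w$ independent of $\mathbf j$ and $\mathbf m$. Let $\mathbf m=\mathbf m_{\mathbf n}\in\mathbb N^q$ satisfy $\mathbf m\to\infty$ as $\mathbf n\to\infty$ and $(m^\star)^3/n_\star=o(1)$, where $m^\star=\max_{1\le i\le q}m_i$ and $n_\star=\min_{1\le i\le q}n_i$. Let $\widehat\sigma_{\mathbf n}^2=\sum_{|\mathbf j|\le\mathbf m}w_{\mathbf m}(\mathbf j)\widehat\gamma_{\mathbf n}(\mathbf j)$. Then, if $p=1$, $\mathbb E\big[(\widehat\sigma_{\mathbf n}^2-\sigma^2)^2\big]\to0$ as $\mathbf n\to\infty$; and if $p>1$, $\mathbb E\|\widehat\sigma_{\mathbf n}^2-\sigma^2\|_\infty\to0$ as $\mathbf n\to\infty$.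
   Context: Fix integers $p,q\ge1$. For $\mathbf n=(n_1,\dots,n_q)\in\mathbb N^q$, $\mathbf n\to\infty$ means $\min_i n_i\to\infty$ (likewise for $\mathbf m$). $|\mathbf n|=\prod_i n_i$, $\Gamma_{\mathbf n}=\{1,\dots,n_1\}\times\dots\times\{1,\dots,n_q\}$. For $\mathbf j\in\mathbb Z^q$, $|\mathbf j|\le\mathbf m$ means $|j_i|\le m_i$ for all $i$. Random fields take values in $\mathbb R^p$ (column vectors $\xi_{\mathbf i}=(\xi_{\mathbf i}^{(1)},\dots,\xi_{\mathbf i}^{(p)})'$, where $'$ is transposition). For a matrix $A=(a_{ij})$, $\|A\|_\infty=\max_{i,j}|a_{ij}|$. Mixing: for $1\le j\le q$ and $r\ge0$ let $\mathcal A^+(j;r)=\sigma(\xi_{\mathbf n}:n_j\ge r,\ n_i \text{ unrestricted for } i\ne j)$ and $\mathcal A^-(j;r)=\sigma(\xi_{\mathbf n}:n_j\le r,\ n_i\text{ unrestricted for } i\neq j)$. For $r\ge1$ let $\varphi(j;r)=\sup\{|\mathbb P(B|A)-\mathbb P(B)|:A\in\mathcal A^-(j;0),B\in\mathcal A^+(j;r),\mathbb P(A)>0\}$, $\varphi(r)=\max_{1\le j\le q}\varphi(j;r)$, and $\varphi(0)=1$. The field is $\varphi$-mixing if $\varphi(r)\to0$ as $r\to\infty$. Autocovariances: $\gamma(\mathbf j)=\mathbb E(\xi_{\mathbf 0}\xi_{\mathbf j}')$ and $\widehat\gamma_{\mathbf n}(\mathbf j)=|\widetilde\Gamma_{\mathbf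 n}(\mathbf j)|^{-1}\sum_{\mathbf i\in\widetilde\Gamma_{\mathbf n}(\mathbf j)}\xi_{\mathbf i}\xi_{\mathbf i+\mathbf j}'$, where $\widetilde\Gamma_{\mathbf n}(\mathbf j)=\{\mathbf i\in\Gamma_{\mathbf n}:\mathbf i+\mathbf j\in\Gamma_{\mathbf n}\}$. The asymptotic variance is the $p\times p$ matrix $\sigma^2=\sum_{\mathbf k\in\mathbb Z^q}\mathbb E(\xi_{\mathbf 0}\xi_{\mathbf k}')=\lim_{\mathbf n\to\infty}|\mathbf n|^{-1}\mathbb E(S_{\mathbf n}S_{\mathbf n}')$ with $S_{\mathbf n}=\sum_{\mathbf i\in\Gamma_{\mathbf n}}\xi_{\mathbf i}$. The weights $w_{\mathbf m}(\mathbf j)$ ($\mathbf m\in\mathbb N^q$, $\mathbf j\in\mathbb Z^q$) are real numbers. *)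

theory Defs
  imports "HOL-Probability.Probability"
begin

text \<open>The filter of \<open>min\<^sub>k n\<^sub>k \<rightarrow> \<infinity>\<close>.\<close>

definition multi_at_top :: "(nat ^ 'q) filter" where
  "multi_at_top = filtercomap (\<lambda>n. MIN k. n $ k) at_top"

definition Gam :: "nat ^ 'q \<Rightarrow> (int ^ 'q) set" where
  "Gam n = {i. \<forall>k. 1 \<le> i $ k \<and> i $ k \<le> int (n $ k)}"

definition Gam_lag :: "nat ^ 'q \<Rightarrow> int ^ 'q \<Rightarrow> (int ^ 'q) set" where
  "Gam_lag n j = {i \<in> Gam n. i + j \<in> Gam n}"

definition lag_window :: "nat ^ 'q \<Rightarrow> (int ^ 'q) set" where
  "lag_window m = {j. \<forall>k. \<bar>j $ k\<bar> \<le> int (m $ k)}"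

text \<open>Equality of all finite-dimensional distributions under every shift.\<close>

definition strictly_stationary ::
    "'w measure \<Rightarrow> (int ^ 'q \<Rightarrow> 'w \<Rightarrow> 'b::topological_space) \<Rightarrow> bool" where
  "strictly_stationary M \<xi> \<longleftrightarrow>
     (\<forall>I h. finite I \<longrightarrow>
        distr M (Pi\<^sub>M I (\<lambda>_. borel)) (\<lambda>\<omega>. \<lambda>i\<in>I. \<xi> (i + h) \<omega>) =
        distr M (Pi\<^sub>M I (\<lambda>_. borel)) (\<lambda>\<omega>. \<lambda>i\<in>I. \<xi> i \<omega>))"

definition sigma_generated ::
    "'w measure \<Rightarrow> ('i \<Rightarrow> 'w \<Rightarrow> 'b::topological_space) \<Rightarrow> 'i set \<Rightarrow> 'w set set" where
  "sigma_generated M \<xi> I =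
     sigma_sets (space M) {\<xi> i -` B \<inter> space M | i B. i \<in> I \<and> B \<in> sets borel}"

definition sigma_plus ::
    "'w measure \<Rightarrow> (int ^ 'q \<Rightarrow> 'w \<Rightarrow> 'b::topological_space) \<Rightarrow> 'q \<Rightarrow> nat \<Rightarrow> 'w set set" where
  "sigma_plus M \<xi> j r = sigma_generated M \<xi> {n. n $ j \<ge> int r}"

definition sigma_minus ::
    "'w measure \<Rightarrow> (int ^ 'q \<Rightarrow> 'w \<Rightarrow> 'b::topological_space) \<Rightarrow> 'q \<Rightarrow> nat \<Rightarrow> 'w set set" where
  "sigma_minus M \<xi> j r = sigma_generated M \<xi> {n. n $ j \<le> int r}"

text \<open>The set below contains \<open>0\<close> (take \<open>A = B = space M\<close>) and is bounded by \<open>1\<close> whenever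
  \<open>M\<close> is a probability space and \<open>\<xi>\<close> is measurable, so the real-valued supremum is proper.\<close>

definition phi_dir ::
    "'w measure \<Rightarrow> (int ^ 'q \<Rightarrow> 'w \<Rightarrow> 'b::topological_space) \<Rightarrow> 'q \<Rightarrow> nat \<Rightarrow> real" where
  "phi_dir M \<xi> j r =
     Sup {\<bar>\<P>(\<omega> in M. \<omega> \<in> B \<bar> \<omega> \<in> A) - measure M B\<bar> | A B.
            A \<in> sigma_minus M \<xi> j 0 \<and> B \<in> sigma_plus M \<xi> j r \<and> measure M A > 0}"

definition phi ::
    "'w measure \<Rightarrow> (int ^ 'q \<Rightarrow> 'w \<Rightarrow> 'b::topological_space) \<Rightarrow> nat \<Rightarrow> real" where
  "phi M \<xi> r = (if r = 0 then 1 else MAX j. phi_dir M \<xi> j r)"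

definition phi_mixing ::
    "'w measure \<Rightarrow> (int ^ 'q \<Rightarrow> 'w \<Rightarrow> 'b::topological_space) \<Rightarrow> bool" where
  "phi_mixing M \<xi> \<longleftrightarrow> phi M \<xi> \<longlonglongrightarrow> 0"

definition max_norm :: "real ^ 'n ^ 'm \<Rightarrow> real" where
  "max_norm A = Max {\<bar>A $ a $ b\<bar> | a b. True}"

text \<open>The matrix \<open>x y'\<close> for column vectors \<open>x\<close> and \<open>y\<close>.\<close>

definition outer :: "real ^ 'm \<Rightarrow> real ^ 'n \<Rightarrow> real ^ 'n ^ 'm" where
  "outer x y = (\<chi> a b. x $ a * y $ b)"

definition autocov ::
    "'w measure \<Rightarrow> (int ^ 'q \<Rightarrow> 'w \<Rightarrow> real ^ 'p) \<Rightarrow> int ^ 'q \<Rightarrow> real ^ 'p ^ 'p" where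
  "autocov M \<xi> j = (\<integral>\<omega>. outer (\<xi> 0 \<omega>) (\<xi> j \<omega>) \<partial>M)"

text \<open>Normalised by the number of available pairs at the given lag, not by the sample size; equal to
  \<open>0\<close> if there are no such pairs.\<close>

definition autocov_est ::
    "(int ^ 'q \<Rightarrow> 'w \<Rightarrow> real ^ 'p) \<Rightarrow> nat ^ 'q \<Rightarrow> int ^ 'q \<Rightarrow> 'w \<Rightarrow> real ^ 'p ^ 'p" where
  "autocov_est \<xi> n j \<omega> =
     (1 / real (card (Gam_lag n j))) *\<^sub>R (\<Sum>i\<in>Gam_lag n j. outer (\<xi> i \<omega>) (\<xi> (i + j) \<omega>))"

text \<open>Unordered summation over the lattice; the value is only meaningful when the autocovariances
  are summable, as they are for a stationary field with finite second moments and
  \<open>\<Sum>r\<ge>1. r\<^bsup>q-1\<^esup> \<phi>(r)\<^bsup>1/2\<^esup> < \<infinity>\<close>.\<close>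

definition asymp_var ::
    "'w measure \<Rightarrow> (int ^ 'q \<Rightarrow> 'w \<Rightarrow> real ^ 'p) \<Rightarrow> real ^ 'p ^ 'p" where
  "asymp_var M \<xi> = (\<Sum>\<^sub>\<infinity>k. autocov M \<xi> k)"

definition var_est ::
    "(nat ^ 'q \<Rightarrow> int ^ 'q \<Rightarrow> real) \<Rightarrow> (int ^ 'q \<Rightarrow> 'w \<Rightarrow> real ^ 'p) \<Rightarrow>
      nat ^ 'q \<Rightarrow> nat ^ 'q \<Rightarrow> 'w \<Rightarrow> real ^ 'p ^ 'p" where
  "var_est w \<xi> m n \<omega> = (\<Sum>j\<in>lag_window m. w m j *\<^sub>R autocov_est \<xi> n j \<omega>)"

end

theory Submission
  imports Defs
begin

text \<open>
  Fix an entry \<open>(a, b)\<close> of the matrices and write \<open>q\<close> for the dimension of the lattice. The error of the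
  variance estimator splits into a bias, the difference between the weighted truncated sum and the full sum
  of the true autocovariances, and a stochastic part, the weighted sum over the lag window of the errors of
  the individual empirical autocovariances. It is enough to show that both vanish in mean square; the
  expected maximum norm is then controlled by the sum over the entries of the root mean square errors.

  Everything rests on the covariance inequality \<open>\<bar>Cov(X, Y)\<bar> \<le> 2 * sqrt \<phi> * \<parallel>X\<parallel> * \<parallel>Y\<parallel>\<close> in the \<open>L2\<close> norm
  (\<open>mixing_covariance\<close>). Applied to single coordinates, it bounds the autocovariance at lag \<open>j\<close> by a
  multiple of the root of the mixing coefficient at the maximum norm of \<open>j\<close>. A sphere of radius \<open>r\<close> has
  of the order of \<open>r ^ (q - 1)\<close> lattice points, so the summability hypothesis makes the autocovariances
  absolutely summable, and the bias tends to \<open>0\<close> by dominated convergence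
  (\<open>tendsto_weighted_sum_infsum\<close>).

  For the stochastic part, the inequality is applied to the products \<open>\<xi> i $ a * \<xi> (i + j) $ b\<close> and
  \<open>\<xi> k $ a * \<xi> (k + j) $ b\<close>, which have second moments because the field has fourth moments. Their pairs of
  sites are separated along a coordinate axis by the norm of \<open>k - i\<close> minus the norm of \<open>j\<close>. Summing over
  \<open>k\<close> (\<open>lattice_sum_le\<close>) yields a variance of order \<open>M ^ q / N ^ q\<close> for each empirical autocovariance,
  where \<open>M\<close> is the largest window size and \<open>N\<close> the smallest sample size
  (\<open>autocov_est_mean_square_error\<close>). There are of the order of \<open>M ^ q\<close> lags, so the Cauchy-Schwarz
  inequality bounds the mean square of the stochastic part by a multiple of \<open>(M ^ 3 / N) ^ q\<close>
  (\<open>stochastic_error_bound\<close>).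
\<close>

section \<open>The covariance inequality\<close>

lemma (in prob_space) expectation_finite_range:
  fixes f :: "'b \<Rightarrow> real"
  assumes "finite R" and "\<And>\<omega>. \<omega> \<in> space M \<Longrightarrow> X \<omega> \<in> R"
    and ev: "\<And>z. z \<in> R \<Longrightarrow> X -` {z} \<inter> space M \<in> events"
  shows "expectation (\<lambda>\<omega>. f (X \<omega>)) = (\<Sum>z\<in>R. f z * prob (X -` {z} \<inter> space M))"
proof -
  have "expectation (\<lambda>\<omega>. f (X \<omega>)) =
      expectation (\<lambda>\<omega>. \<Sum>z\<in>R. f z * indicator (X -` {z} \<inter> space M) \<omega>)"
    using assms(1,2) by (intro Bochner_Integration.integral_cong) (auto simp: indicator_def sum.delta')
  also have "\<dots> = (\<Sum>z\<in>R. f z * prob (X -` {z} \<inter> space M))"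
    using ev by (subst Bochner_Integration.integral_sum)
      (auto intro!: integrable_real_indicator simp: emeasure_eq_measure simp flip: Int_assoc)
  finally show ?thesis .
qed

text \<open>For simple functions the covariance is \<open>\<Sum>x y. x * y * d x y\<close>, where \<open>d x y\<close> is the defect of
independence of the level sets \<open>{X = x}\<close> and \<open>{Y = y}\<close>. Cauchy-Schwarz with weights \<open>\<bar>d x y\<bar>\<close> leaves the
two marginal sums of the weights. Splitting the values \<open>y\<close> by the sign of \<open>d x y\<close> and merging the level
sets of \<open>Y\<close> in each part gives two events of the second algebra, so \<open>\<Sum>y. \<bar>d x y\<bar>\<close> is at most
\<open>2 * \<phi> * P(X = x)\<close>; the other marginal is only bounded trivially, by \<open>2 * P(Y = y)\<close>. This asymmetry of the
two estimates is why only the square root of \<open>\<phi>\<close> survives.\<close>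

lemma (in prob_space) mixing_covariance_simple:
  fixes X Y :: "'a \<Rightarrow> real"
  assumes F: "subalgebra M F" and G: "subalgebra M G"
    and mix: "\<And>A B. A \<in> sets F \<Longrightarrow> B \<in> sets G \<Longrightarrow>
        \<bar>prob (A \<inter> B) - prob A * prob B\<bar> \<le> \<phi> * prob A"
    and X: "simple_function F X" and Y: "simple_function G Y"
  shows "\<bar>expectation (\<lambda>\<omega>. X \<omega> * Y \<omega>) - expectation X * expectation Y\<bar>
    \<le> 2 * sqrt \<phi> * sqrt (expectation (\<lambda>\<omega>. (X \<omega>)\<^sup>2)) * sqrt (expectation (\<lambda>\<omega>. (Y \<omega>)\<^sup>2))"
proof -
  have sp: "space F = space M" "space G = space M" "sets F \<subseteq> events" "sets G \<subseteq> events"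
    using F G by (auto simp: subalgebra_def)
  have phi0: "0 \<le> \<phi>"
    using mix[OF sets.top sets.top] prob_space unfolding sp by simp
  define RX where "RX = X ` space M"
  define RY where "RY = Y ` space M"
  define A where "A x = X -` {x} \<inter> space M" for x
  define B where "B y = Y -` {y} \<inter> space M" for y
  have fin: "finite RX" "finite RY"
    using X Y sp by (auto simp: simple_function_def RX_def RY_def)
  have A: "A x \<in> sets F" if "x \<in> RX" for x
    using X sp that by (auto simp: simple_function_def RX_def A_def)
  have B: "B y \<in> sets G" if "y \<in> RY" for y
    using Y sp that by (auto simp: simple_function_def RY_def B_def)
  have Aev: "A x \<in> events" if "x \<in> RX" for x using A[OF that] sp by auto
  have Bev: "B y \<in> events" if "y \<in> RY" for y using B[OF that] sp by auto
  define d where "d x y = prob (A x \<inter> B y) - prob (A x) * prob (B y)" for x y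
  have EX: "expectation (\<lambda>\<omega>. f (X \<omega>)) = (\<Sum>x\<in>RX. f x * prob (A x))" for f :: "real \<Rightarrow> real"
    unfolding A_def using Aev
    by (intro expectation_finite_range fin) (auto simp: RX_def A_def)
  have EY: "expectation (\<lambda>\<omega>. f (Y \<omega>)) = (\<Sum>y\<in>RY. f y * prob (B y))" for f :: "real \<Rightarrow> real"
    unfolding B_def using Bev
    by (intro expectation_finite_range fin) (auto simp: RY_def B_def)
  have AB: "(\<lambda>\<omega>. (X \<omega>, Y \<omega>)) -` {z} \<inter> space M = A (fst z) \<inter> B (snd z)" for z
    by (auto simp: A_def B_def)
  have "expectation (\<lambda>\<omega>. X \<omega> * Y \<omega>)
      = (\<Sum>z\<in>RX \<times> RY. fst z * snd z * prob (A (fst z) \<inter> B (snd z)))"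
    using expectation_finite_range[of "RX \<times> RY" "\<lambda>\<omega>. (X \<omega>, Y \<omega>)" "\<lambda>z. fst z * snd z"]
      fin Aev Bev unfolding AB by (auto simp: RX_def RY_def)
  also have "\<dots> = (\<Sum>x\<in>RX. \<Sum>y\<in>RY. x * y * prob (A x \<inter> B y))"
    by (simp add: sum.cartesian_product split_beta)
  finally have EXY: "expectation (\<lambda>\<omega>. X \<omega> * Y \<omega>) = (\<Sum>x\<in>RX. \<Sum>y\<in>RY. x * y * prob (A x \<inter> B y))" .
  have cov: "expectation (\<lambda>\<omega>. X \<omega> * Y \<omega>) - expectation X * expectation Y
      = (\<Sum>z\<in>RX \<times> RY. fst z * snd z * d (fst z) (snd z))"
    using EXY EX[of "\<lambda>x. x"] EY[of "\<lambda>x. x"]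
    by (simp add: d_def sum_product sum_subtractf algebra_simps sum.cartesian_product split_beta)
  have Bdisj: "disjoint_family_on B S" for S
    by (auto simp: disjoint_family_on_def B_def)
  have Adisj: "disjoint_family_on A S" for S
    by (auto simp: disjoint_family_on_def A_def)
  \<comment> \<open>All partial sums of \<open>d x\<close> are defects of a single event, hence controlled by mixing.\<close>
  have half: "\<bar>\<Sum>y\<in>S. d x y\<bar> \<le> \<phi> * prob (A x)" if "x \<in> RX" "S \<subseteq> RY" for x S
  proof -
    have finS: "finite S" using that fin finite_subset by auto
    have "(\<Sum>y\<in>S. prob (A x \<inter> B y)) = prob (\<Union>y\<in>S. A x \<inter> B y)"
      using that Aev Bev Bdisj[of S] finS
      by (intro finite_measure_finite_Union[symmetric]) (auto simp: disjoint_family_on_def B_def)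
    moreover have "(\<Sum>y\<in>S. prob (B y)) = prob (\<Union>y\<in>S. B y)"
      using that Aev Bev Bdisj[of S] finS
      by (intro finite_measure_finite_Union[symmetric]) auto
    moreover have "(\<Union>y\<in>S. B y) \<in> sets G"
      using that B finS by (intro sets.finite_UN) auto
    moreover have "(\<Union>y\<in>S. A x \<inter> B y) = A x \<inter> (\<Union>y\<in>S. B y)" by auto
    ultimately show ?thesis
      using mix[OF A[OF that(1)], of "\<Union>y\<in>S. B y"]
      by (simp add: d_def sum_subtractf flip: sum_distrib_left)
  qed
  have dy: "(\<Sum>y\<in>RY. \<bar>d x y\<bar>) \<le> 2 * \<phi> * prob (A x)" if x: "x \<in> RX" for x
  proof -
    have "(\<Sum>y\<in>RY. \<bar>d x y\<bar>) = (\<Sum>y\<in>{y\<in>RY. d x y \<ge> 0}. \<bar>d x y\<bar>) + (\<Sum>y\<in>{y\<in>RY. \<not> d x y \<ge> 0}. \<bar>d x y\<bar>)"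
      using fin by (subst sum.union_disjoint[symmetric]) (auto intro!: sum.cong)
    also have "(\<Sum>y\<in>{y\<in>RY. d x y \<ge> 0}. \<bar>d x y\<bar>) = (\<Sum>y\<in>{y\<in>RY. d x y \<ge> 0}. d x y)"
      by (intro sum.cong) auto
    also have "(\<Sum>y\<in>{y\<in>RY. \<not> d x y \<ge> 0}. \<bar>d x y\<bar>) = - (\<Sum>y\<in>{y\<in>RY. \<not> d x y \<ge> 0}. d x y)"
      by (subst sum_negf[symmetric], intro sum.cong) auto
    also have "(\<Sum>y\<in>{y\<in>RY. d x y \<ge> 0}. d x y) + - (\<Sum>y\<in>{y\<in>RY. \<not> d x y \<ge> 0}. d x y)
        \<le> 2 * (\<phi> * prob (A x))"
      using half[OF x, of "{y\<in>RY. d x y \<ge> 0}"] half[OF x, of "{y\<in>RY. \<not> d x y \<ge> 0}"] by force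
    finally show ?thesis by simp
  qed
  have dx: "(\<Sum>x\<in>RX. \<bar>d x y\<bar>) \<le> 2 * prob (B y)" if y: "y \<in> RY" for y
  proof -
    have "(\<Sum>x\<in>RX. \<bar>d x y\<bar>) \<le> (\<Sum>x\<in>RX. prob (A x \<inter> B y) + prob (A x) * prob (B y))"
    proof (intro sum_mono)
      fix x
      have "0 \<le> prob (A x) * prob (B y)" by simp
      then show "\<bar>d x y\<bar> \<le> prob (A x \<inter> B y) + prob (A x) * prob (B y)"
        using measure_nonneg[of M "A x \<inter> B y"] unfolding d_def by linarith
    qed
    also have "\<dots> = prob (\<Union>x\<in>RX. A x \<inter> B y) + prob (\<Union>x\<in>RX. A x) * prob (B y)"
      using Aev Bev y fin Adisj[of RX] unfolding sum.distrib sum_distrib_right[symmetric]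
      by (subst (1 2) finite_measure_finite_Union) (auto simp: disjoint_family_on_def A_def)
    also have "\<dots> \<le> prob (B y) + 1 * prob (B y)"
      using Bev[OF y] by (intro add_mono mult_right_mono prob_le_1 finite_measure_mono) auto
    finally show ?thesis by simp
  qed
  have cs_term: "(\<bar>x\<bar> * sqrt \<bar>e\<bar>) * (\<bar>y\<bar> * sqrt \<bar>e\<bar>) = \<bar>x * y * e\<bar>" for x y e :: real
  proof -
    have "(\<bar>x\<bar> * sqrt \<bar>e\<bar>) * (\<bar>y\<bar> * sqrt \<bar>e\<bar>) = \<bar>x\<bar> * \<bar>y\<bar> * (sqrt \<bar>e\<bar> * sqrt \<bar>e\<bar>)" by (simp only: mult_ac)
    then show ?thesis by (simp add: abs_mult)
  qed
  have "(\<Sum>z\<in>RX \<times> RY. (\<bar>fst z\<bar> * sqrt \<bar>d (fst z) (snd z)\<bar>) * (\<bar>snd z\<bar> * sqrt \<bar>d (fst z) (snd z)\<bar>))\<^sup>2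
      \<le> (\<Sum>z\<in>RX \<times> RY. (\<bar>fst z\<bar> * sqrt \<bar>d (fst z) (snd z)\<bar>)\<^sup>2) *
        (\<Sum>z\<in>RX \<times> RY. (\<bar>snd z\<bar> * sqrt \<bar>d (fst z) (snd z)\<bar>)\<^sup>2)"
    by (rule Cauchy_Schwarz_ineq_sum)
  also have "(\<Sum>z\<in>RX \<times> RY. (\<bar>fst z\<bar> * sqrt \<bar>d (fst z) (snd z)\<bar>)\<^sup>2)
      = (\<Sum>x\<in>RX. x\<^sup>2 * (\<Sum>y\<in>RY. \<bar>d x y\<bar>))"
    by (simp add: power_mult_distrib sum_distrib_left sum.cartesian_product split_beta)
  also have "(\<Sum>z\<in>RX \<times> RY. (\<bar>snd z\<bar> * sqrt \<bar>d (fst z) (snd z)\<bar>)\<^sup>2)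
      = (\<Sum>y\<in>RY. y\<^sup>2 * (\<Sum>x\<in>RX. \<bar>d x y\<bar>))"
    by (subst sum_distrib_left, subst sum.swap)
      (simp add: power_mult_distrib sum.cartesian_product split_beta)
  also have "(\<Sum>x\<in>RX. x\<^sup>2 * (\<Sum>y\<in>RY. \<bar>d x y\<bar>)) * (\<Sum>y\<in>RY. y\<^sup>2 * (\<Sum>x\<in>RX. \<bar>d x y\<bar>))
      \<le> (\<Sum>x\<in>RX. x\<^sup>2 * (2 * \<phi> * prob (A x))) * (\<Sum>y\<in>RY. y\<^sup>2 * (2 * prob (B y)))"
    using dx dy phi0
    by (intro mult_mono sum_mono mult_left_mono sum_nonneg mult_nonneg_nonneg) auto
  also have "\<dots> = 4 * \<phi> * expectation (\<lambda>\<omega>. (X \<omega>)\<^sup>2) * expectation (\<lambda>\<omega>. (Y \<omega>)\<^sup>2)"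
  proof -
    have "(\<Sum>x\<in>RX. x\<^sup>2 * (2 * \<phi> * prob (A x))) = 2 * \<phi> * expectation (\<lambda>\<omega>. (X \<omega>)\<^sup>2)"
      unfolding EX[of "\<lambda>x. x\<^sup>2"] sum_distrib_left by (intro sum.cong) auto
    moreover have "(\<Sum>y\<in>RY. y\<^sup>2 * (2 * prob (B y))) = 2 * expectation (\<lambda>\<omega>. (Y \<omega>)\<^sup>2)"
      unfolding EY[of "\<lambda>x. x\<^sup>2"] sum_distrib_left by (intro sum.cong) auto
    ultimately show ?thesis by simp
  qed
  finally have *: "(\<Sum>z\<in>RX \<times> RY. \<bar>fst z * snd z * d (fst z) (snd z)\<bar>)\<^sup>2
      \<le> 4 * \<phi> * expectation (\<lambda>\<omega>. (X \<omega>)\<^sup>2) * expectation (\<lambda>\<omega>. (Y \<omega>)\<^sup>2)"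
    unfolding cs_term .
  have "\<bar>expectation (\<lambda>\<omega>. X \<omega> * Y \<omega>) - expectation X * expectation Y\<bar>
      \<le> (\<Sum>z\<in>RX \<times> RY. \<bar>fst z * snd z * d (fst z) (snd z)\<bar>)"
    unfolding cov by (rule sum_abs)
  also have "\<dots> \<le> sqrt (4 * \<phi> * expectation (\<lambda>\<omega>. (X \<omega>)\<^sup>2) * expectation (\<lambda>\<omega>. (Y \<omega>)\<^sup>2))"
    using * by (rule real_le_rsqrt)
  finally show ?thesis by (simp add: real_sqrt_mult)
qed

lemma (in prob_space) integrable_mult_of_squares:
  fixes X Y :: "'a \<Rightarrow> real"
  assumes [measurable]: "X \<in> borel_measurable M" "Y \<in> borel_measurable M"
    and "integrable M (\<lambda>\<omega>. (X \<omega>)\<^sup>2)" "integrable M (\<lambda>\<omega>. (Y \<omega>)\<^sup>2)"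
  shows "integrable M (\<lambda>\<omega>. X \<omega> * Y \<omega>)"
proof (rule Bochner_Integration.integrable_bound)
  show "integrable M (\<lambda>\<omega>. (X \<omega>)\<^sup>2 + (Y \<omega>)\<^sup>2)" using assms by simp
  have "\<bar>x * y\<bar> \<le> x\<^sup>2 + y\<^sup>2" for x y :: real
  proof -
    have "2 * (\<bar>x\<bar> * \<bar>y\<bar>) \<le> x\<^sup>2 + y\<^sup>2" using sum_squares_bound[of "\<bar>x\<bar>" "\<bar>y\<bar>"] by simp
    moreover have "0 \<le> \<bar>x\<bar> * \<bar>y\<bar>" by simp
    ultimately show ?thesis unfolding abs_mult by linarith
  qed
  then show "AE \<omega> in M. norm (X \<omega> * Y \<omega>) \<le> norm ((X \<omega>)\<^sup>2 + (Y \<omega>)\<^sup>2)" by simp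
qed simp

lemma (in prob_space) integrable_of_square:
  fixes X :: "'a \<Rightarrow> real"
  assumes "X \<in> borel_measurable M" "integrable M (\<lambda>\<omega>. (X \<omega>)\<^sup>2)"
  shows "integrable M X"
  using integrable_mult_of_squares[of X "\<lambda>_. 1"] assms by simp

text \<open>The general case follows by dominated convergence: \<open>X\<close> and \<open>Y\<close> are pointwise limits of simple functions
of the same algebras that are dominated by \<open>2 * \<bar>X\<bar>\<close> and \<open>2 * \<bar>Y\<bar>\<close>.\<close>

lemma (in prob_space) mixing_covariance:
  fixes X Y :: "'a \<Rightarrow> real"
  assumes F: "subalgebra M F" and G: "subalgebra M G"
    and mix: "\<And>A B. A \<in> sets F \<Longrightarrow> B \<in> sets G \<Longrightarrow>
        \<bar>prob (A \<inter> B) - prob A * prob B\<bar> \<le> \<phi> * prob A"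
    and X: "X \<in> borel_measurable F" and Y: "Y \<in> borel_measurable G"
    and X2: "integrable M (\<lambda>\<omega>. (X \<omega>)\<^sup>2)" and Y2: "integrable M (\<lambda>\<omega>. (Y \<omega>)\<^sup>2)"
  shows "\<bar>expectation (\<lambda>\<omega>. X \<omega> * Y \<omega>) - expectation X * expectation Y\<bar>
    \<le> 2 * sqrt \<phi> * sqrt (expectation (\<lambda>\<omega>. (X \<omega>)\<^sup>2)) * sqrt (expectation (\<lambda>\<omega>. (Y \<omega>)\<^sup>2))"
proof -
  have sp: "space F = space M" "space G = space M"
    using F G by (auto simp: subalgebra_def)
  have "\<exists>s. (\<forall>i. simple_function F (s i)) \<and> (\<forall>x\<in>space M. (\<lambda>i. s i x) \<longlonglongrightarrow> X x) \<and>
      (\<forall>i. \<forall>x\<in>space M. \<bar>s i x\<bar> \<le> 2 * \<bar>X x\<bar>)"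
    using borel_measurable_implies_sequence_metric[OF X, of 0] sp by (simp add: dist_real_def)
  then
  obtain s where s: "\<And>i. simple_function F (s i)" "\<And>x. x \<in> space M \<Longrightarrow> (\<lambda>i. s i x) \<longlonglongrightarrow> X x"
      "\<And>i x. x \<in> space M \<Longrightarrow> \<bar>s i x\<bar> \<le> 2 * \<bar>X x\<bar>"
    by blast
  have "\<exists>s. (\<forall>i. simple_function G (s i)) \<and> (\<forall>x\<in>space M. (\<lambda>i. s i x) \<longlonglongrightarrow> Y x) \<and>
      (\<forall>i. \<forall>x\<in>space M. \<bar>s i x\<bar> \<le> 2 * \<bar>Y x\<bar>)"
    using borel_measurable_implies_sequence_metric[OF Y, of 0] sp by (simp add: dist_real_def)
  then
  obtain t where t: "\<And>i. simple_function G (t i)" "\<And>x. x \<in> space M \<Longrightarrow> (\<lambda>i. t i x) \<longlonglongrightarrow> Y x"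
      "\<And>i x. x \<in> space M \<Longrightarrow> \<bar>t i x\<bar> \<le> 2 * \<bar>Y x\<bar>"
    by blast
  have [measurable]: "X \<in> borel_measurable M" "Y \<in> borel_measurable M"
    "\<And>i. s i \<in> borel_measurable M" "\<And>i. t i \<in> borel_measurable M"
    using measurable_from_subalg[OF F X] measurable_from_subalg[OF G Y]
      measurable_from_subalg[OF F borel_measurable_simple_function[OF s(1)]]
      measurable_from_subalg[OF G borel_measurable_simple_function[OF t(1)]] by auto
  have iXY: "integrable M (\<lambda>\<omega>. X \<omega> * Y \<omega>)"
    by (rule integrable_mult_of_squares) (use X2 Y2 in auto)
  have iX: "integrable M X" and iY: "integrable M Y"
    using X2 Y2 by (auto intro: integrable_of_square)
  have 1: "(\<lambda>i. expectation (\<lambda>\<omega>. s i \<omega> * t i \<omega>)) \<longlonglongrightarrow> expectation (\<lambda>\<omega>. X \<omega> * Y \<omega>)"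
  proof (rule integral_dominated_convergence[where w = "\<lambda>\<omega>. 4 * \<bar>X \<omega> * Y \<omega>\<bar>"])
    show "AE \<omega> in M. norm (s i \<omega> * t i \<omega>) \<le> 4 * \<bar>X \<omega> * Y \<omega>\<bar>" for i
    proof (rule AE_I2)
      fix \<omega> assume "\<omega> \<in> space M"
      then have "\<bar>s i \<omega>\<bar> * \<bar>t i \<omega>\<bar> \<le> (2 * \<bar>X \<omega>\<bar>) * (2 * \<bar>Y \<omega>\<bar>)"
        using s(3) t(3) by (intro mult_mono) auto
      then show "norm (s i \<omega> * t i \<omega>) \<le> 4 * \<bar>X \<omega> * Y \<omega>\<bar>" by (simp add: abs_mult)
    qed
  qed (use iXY s t in \<open>auto intro!: tendsto_mult\<close>)
  have 2: "(\<lambda>i. expectation (s i)) \<longlonglongrightarrow> expectation X"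
    by (rule integral_dominated_convergence[where w = "\<lambda>\<omega>. 2 * \<bar>X \<omega>\<bar>"]) (use iX s in auto)
  have 3: "(\<lambda>i. expectation (t i)) \<longlonglongrightarrow> expectation Y"
    by (rule integral_dominated_convergence[where w = "\<lambda>\<omega>. 2 * \<bar>Y \<omega>\<bar>"]) (use iY t in auto)
  have sq: "x\<^sup>2 \<le> 4 * y\<^sup>2" if "\<bar>x\<bar> \<le> 2 * \<bar>y\<bar>" for x y :: real
    using power_mono[OF that, of 2] by (simp add: power_mult_distrib)
  have 4: "(\<lambda>i. expectation (\<lambda>\<omega>. (s i \<omega>)\<^sup>2)) \<longlonglongrightarrow> expectation (\<lambda>\<omega>. (X \<omega>)\<^sup>2)"
    by (rule integral_dominated_convergence[where w = "\<lambda>\<omega>. 4 * (X \<omega>)\<^sup>2"])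
      (use X2 s sq in \<open>auto intro!: tendsto_power\<close>)
  have 5: "(\<lambda>i. expectation (\<lambda>\<omega>. (t i \<omega>)\<^sup>2)) \<longlonglongrightarrow> expectation (\<lambda>\<omega>. (Y \<omega>)\<^sup>2)"
    by (rule integral_dominated_convergence[where w = "\<lambda>\<omega>. 4 * (Y \<omega>)\<^sup>2"])
      (use Y2 t sq in \<open>auto intro!: tendsto_power\<close>)
  show ?thesis
  proof (rule LIMSEQ_le)
    show "(\<lambda>i. \<bar>expectation (\<lambda>\<omega>. s i \<omega> * t i \<omega>) - expectation (s i) * expectation (t i)\<bar>)
        \<longlonglongrightarrow> \<bar>expectation (\<lambda>\<omega>. X \<omega> * Y \<omega>) - expectation X * expectation Y\<bar>"
      by (intro tendsto_intros 1 2 3)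
    show "(\<lambda>i. 2 * sqrt \<phi> * sqrt (expectation (\<lambda>\<omega>. (s i \<omega>)\<^sup>2)) * sqrt (expectation (\<lambda>\<omega>. (t i \<omega>)\<^sup>2)))
        \<longlonglongrightarrow> 2 * sqrt \<phi> * sqrt (expectation (\<lambda>\<omega>. (X \<omega>)\<^sup>2)) * sqrt (expectation (\<lambda>\<omega>. (Y \<omega>)\<^sup>2))"
      by (intro tendsto_intros 4 5)
  qed (rule exI allI impI mixing_covariance_simple F G mix s(1) t(1) | assumption)+
qed

lemma (in prob_space) integrable_square_sum:
  fixes X :: "'i \<Rightarrow> 'a \<Rightarrow> real"
  assumes "\<And>i. i \<in> I \<Longrightarrow> X i \<in> borel_measurable M" "\<And>i. i \<in> I \<Longrightarrow> integrable M (\<lambda>\<omega>. (X i \<omega>)\<^sup>2)"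
  shows "integrable M (\<lambda>\<omega>. (\<Sum>i\<in>I. X i \<omega>)\<^sup>2)"
  unfolding power2_eq_square sum_product
  by (intro Bochner_Integration.integrable_sum integrable_mult_of_squares assms)

lemma (in prob_space) expectation_abs_le:
  fixes X :: "'a \<Rightarrow> real"
  assumes [measurable]: "X \<in> borel_measurable M" and X2: "integrable M (\<lambda>\<omega>. (X \<omega>)\<^sup>2)"
  shows "expectation (\<lambda>\<omega>. \<bar>X \<omega>\<bar>) \<le> sqrt (expectation (\<lambda>\<omega>. (X \<omega>)\<^sup>2))"
proof -
  have "integrable M (\<lambda>\<omega>. \<bar>X \<omega>\<bar>)" using integrable_of_square[OF assms] by simp
  then have "variance (\<lambda>\<omega>. \<bar>X \<omega>\<bar>) = expectation (\<lambda>\<omega>. \<bar>X \<omega>\<bar>\<^sup>2) - (expectation (\<lambda>\<omega>. \<bar>X \<omega>\<bar>))\<^sup>2"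
    using X2 by (intro variance_eq) auto
  then show ?thesis using variance_positive[of "\<lambda>\<omega>. \<bar>X \<omega>\<bar>"] by (intro real_le_rsqrt) simp
qed

section \<open>Counting lattice points\<close>

definition lattice_norm :: "int ^ 'q::finite \<Rightarrow> nat" where
  "lattice_norm d = (MAX k. nat \<bar>d $ k\<bar>)"

lemma lattice_norm_le_iff: "lattice_norm d \<le> r \<longleftrightarrow> (\<forall>k. \<bar>d $ k\<bar> \<le> int r)"
  by (auto simp: lattice_norm_def nat_le_iff)

lemma lattice_norm_attained: "\<exists>k. \<bar>d $ k\<bar> = int (lattice_norm d)"
proof -
  have "lattice_norm d \<in> (\<lambda>k. nat \<bar>d $ k\<bar>) ` UNIV"
    unfolding lattice_norm_def by (rule Max_in) auto
  then show ?thesis by auto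
qed

lemma
  fixes A :: "'q::finite \<Rightarrow> 'b set"
  assumes "\<And>k. finite (A k)"
  shows finite_vec_box: "finite {d :: 'b ^ 'q. \<forall>k. d $ k \<in> A k}"
    and card_vec_box: "card {d :: 'b ^ 'q. \<forall>k. d $ k \<in> A k} = (\<Prod>k\<in>UNIV. card (A k))"
proof -
  have eq: "{d :: 'b ^ 'q. \<forall>k. d $ k \<in> A k} = vec_lambda ` (Pi\<^sub>E UNIV A)"
  proof (intro set_eqI iffI)
    fix d :: "'b ^ 'q" assume "d \<in> {d. \<forall>k. d $ k \<in> A k}"
    then show "d \<in> vec_lambda ` (Pi\<^sub>E UNIV A)"
      by (intro image_eqI[of _ _ "vec_nth d"]) auto
  qed auto
  have inj: "inj_on (vec_lambda :: _ \<Rightarrow> 'b ^ 'q) (Pi\<^sub>E UNIV A)"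
    by (intro inj_onI) (metis vec_lambda_inject UNIV_I)
  show "finite {d :: 'b ^ 'q. \<forall>k. d $ k \<in> A k}"
    unfolding eq using assms by (intro finite_imageI finite_PiE) auto
  show "card {d :: 'b ^ 'q. \<forall>k. d $ k \<in> A k} = (\<Prod>k\<in>UNIV. card (A k))"
    unfolding eq card_image[OF inj] by (rule card_PiE) auto
qed

lemma lattice_ball_eq: "{d :: int ^ 'q::finite. lattice_norm d \<le> r} = {d. \<forall>k. d $ k \<in> {- int r..int r}}"
  by (auto simp: lattice_norm_le_iff abs_le_iff minus_le_iff)

lemma finite_lattice_ball: "finite {d :: int ^ 'q::finite. lattice_norm d \<le> r}"
  unfolding lattice_ball_eq by (rule finite_vec_box) auto

lemma card_lattice_ball: "card {d :: int ^ 'q::finite. lattice_norm d \<le> r} = (2 * r + 1) ^ CARD('q)"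
proof -
  have "nat (1 + int r * 2) = 2 * r + 1" by simp
  then show ?thesis
    unfolding lattice_ball_eq by (subst card_vec_box) (auto simp: algebra_simps)
qed

lemma power_diff_le:
  fixes x y :: real
  assumes "0 \<le> y" "y \<le> x"
  shows "x ^ n - y ^ n \<le> real n * (x - y) * x ^ (n - 1)"
proof (induction n)
  case (Suc n)
  have "x ^ Suc n - y ^ Suc n = x * (x ^ n - y ^ n) + (x - y) * y ^ n" by (simp add: algebra_simps)
  also have "\<dots> \<le> x * (real n * (x - y) * x ^ (n - 1)) + (x - y) * x ^ n"
    using assms Suc by (intro add_mono mult_left_mono power_mono) auto
  also have "x * (real n * (x - y) * x ^ (n - 1)) = real n * (x - y) * x ^ n"
    by (cases n) auto
  finally show ?case by (simp add: algebra_simps)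
qed simp

text \<open>The volume of the sphere is the difference of two cube volumes, hence of order \<open>r\<close> to the power \<open>q - 1\<close>;
this is where the weight in the summability hypothesis on the mixing coefficients comes from.\<close>

lemma card_lattice_sphere:
  "real (card {d :: int ^ 'q::finite. lattice_norm d = Suc r}) \<le> 2 * real CARD('q) * (2 * real r + 3) ^ (CARD('q) - 1)"
proof -
  have "{d :: int ^ 'q. lattice_norm d = Suc r} = {d. lattice_norm d \<le> Suc r} - {d. lattice_norm d \<le> r}"
    by auto
  moreover have "{d :: int ^ 'q. lattice_norm d \<le> r} \<subseteq> {d. lattice_norm d \<le> Suc r}"
    by auto
  ultimately have "real (card {d :: int ^ 'q. lattice_norm d = Suc r}) =
      real (card {d :: int ^ 'q. lattice_norm d \<le> Suc r}) - real (card {d :: int ^ 'q. lattice_norm d \<le> r})"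
    by (metis card_Diff_subset card_mono finite_lattice_ball of_nat_diff)
  also have "\<dots> = (2 * real r + 3) ^ CARD('q) - (2 * real r + 1) ^ CARD('q)"
    unfolding card_lattice_ball by (simp add: algebra_simps)
  also have "\<dots> \<le> real CARD('q) * 2 * (2 * real r + 3) ^ (CARD('q) - 1)"
    using power_diff_le[of "2 * real r + 1" "2 * real r + 3" "CARD('q)"] by simp
  finally show ?thesis by (simp add: mult_ac)
qed

text \<open>The truncated subtraction makes \<open>\<psi>\<close> constant on the cube of radius \<open>N\<close>, which contributes its volume.
On the sphere of radius \<open>N + r + 1\<close> the value is \<open>\<psi> (r + 1)\<close>, and the number of points is bounded by
\<open>((N + 1) * (r + 1)) ^ (q - 1)\<close> up to a constant, so the spheres contribute even one power of \<open>N + 1\<close>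
less than the cube.\<close>

lemma lattice_sum_le:
  fixes \<psi> :: "nat \<Rightarrow> real"
  assumes nn: "\<And>r. 0 \<le> \<psi> r"
    and sm: "summable (\<lambda>r. real (Suc r) ^ (CARD('q::finite) - 1) * \<psi> (Suc r))"
  obtains C where "0 \<le> C" "\<And>N D. finite D \<Longrightarrow>
    (\<Sum>d\<in>D. \<psi> (lattice_norm (d :: int ^ 'q) - N)) \<le> C * real (N + 1) ^ CARD('q)"
proof
  let ?q = "CARD('q)"
  let ?S = "\<Sum>r. real (Suc r) ^ (?q - 1) * \<psi> (Suc r)"
  let ?C = "2 ^ ?q * \<psi> 0 + 2 * real ?q * 3 ^ (?q - 1) * ?S"
  have S0: "0 \<le> ?S" using nn by (intro suminf_nonneg[OF sm]) auto
  show "0 \<le> ?C" using nn S0 by auto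
  fix N and D :: "(int ^ 'q) set" assume D: "finite D"
  let ?B = "\<lambda>r. {d :: int ^ 'q. lattice_norm d \<le> r}"
  \<comment> \<open>Adding one sphere at a time; \<open>2 * (N + R) + 3 \<le> 3 * (N + 1) * (R + 1)\<close> separates the two radii.\<close>
  have ball: "(\<Sum>d\<in>?B (N + R). \<psi> (lattice_norm d - N)) \<le> (2 * real N + 1) ^ ?q * \<psi> 0 +
      (\<Sum>r<R. 2 * real ?q * (3 * (real N + 1)) ^ (?q - 1) * (real (Suc r) ^ (?q - 1) * \<psi> (Suc r)))" for R
  proof (induction R)
    case 0
    have "(\<Sum>d\<in>?B N. \<psi> (lattice_norm d - N)) = (\<Sum>d\<in>?B N. \<psi> 0)"
      by (intro sum.cong) auto
    then show ?case by (simp add: card_lattice_ball add.commute)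
  next
    case (Suc R)
    have split: "?B (N + Suc R) = ?B (N + R) \<union> {d. lattice_norm d = Suc (N + R)}"
      by (auto simp: le_Suc_eq)
    have fin: "finite {d :: int ^ 'q. lattice_norm d = Suc (N + R)}"
      by (rule finite_subset[OF _ finite_lattice_ball[of "Suc (N + R)"]]) auto
    have "(\<Sum>d\<in>?B (N + Suc R). \<psi> (lattice_norm d - N)) = (\<Sum>d\<in>?B (N + R). \<psi> (lattice_norm d - N))
        + (\<Sum>d\<in>{d :: int ^ 'q. lattice_norm d = Suc (N + R)}. \<psi> (lattice_norm d - N))"
      unfolding split by (rule sum.union_disjoint) (auto simp: finite_lattice_ball fin)
    also have "(\<Sum>d\<in>{d :: int ^ 'q. lattice_norm d = Suc (N + R)}. \<psi> (lattice_norm d - N))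
        = real (card {d :: int ^ 'q. lattice_norm d = Suc (N + R)}) * \<psi> (Suc R)"
      by simp
    also have "\<dots> \<le> (2 * real ?q * (2 * real (N + R) + 3) ^ (?q - 1)) * \<psi> (Suc R)"
      by (intro mult_right_mono card_lattice_sphere nn)
    also have "\<dots> \<le> (2 * real ?q * (3 * (real N + 1) * real (Suc R)) ^ (?q - 1)) * \<psi> (Suc R)"
    proof (intro mult_right_mono mult_left_mono power_mono nn)
      show "2 * real (N + R) + 3 \<le> 3 * (real N + 1) * real (Suc R)"
        by (simp add: algebra_simps)
    qed auto
    finally show ?case using Suc by (simp add: power_mult_distrib mult_ac)
  qed
  define R where "R = (\<Sum>d\<in>D. lattice_norm d)"
  have R: "lattice_norm d \<le> R" if "d \<in> D" for d
    unfolding R_def using that D by (intro member_le_sum) auto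
  have "(\<Sum>d\<in>D. \<psi> (lattice_norm d - N)) \<le> (\<Sum>d\<in>?B (N + R). \<psi> (lattice_norm d - N))"
    using R nn by (intro sum_mono2 finite_lattice_ball) (auto simp: trans_le_add2)
  also note ball[of R]
  also have "(\<Sum>r<R. 2 * real ?q * (3 * (real N + 1)) ^ (?q - 1) * (real (Suc r) ^ (?q - 1) * \<psi> (Suc r)))
      \<le> 2 * real ?q * (3 * (real N + 1)) ^ (?q - 1) * ?S"
    unfolding sum_distrib_left[symmetric] using nn
    by (intro mult_left_mono sum_le_suminf[OF sm]) auto
  also have "\<dots> \<le> 2 * real ?q * (3 ^ (?q - 1) * (real N + 1) ^ ?q) * ?S"
    unfolding power_mult_distrib using S0
    by (intro mult_right_mono mult_left_mono power_increasing) auto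
  also have "(2 * real N + 1) ^ ?q * \<psi> 0 \<le> 2 ^ ?q * (real N + 1) ^ ?q * \<psi> 0"
    unfolding power_mult_distrib[symmetric] using nn by (intro mult_right_mono power_mono) auto
  finally show "(\<Sum>d\<in>D. \<psi> (lattice_norm d - N)) \<le> ?C * real (N + 1) ^ ?q"
    by (simp add: algebra_simps)
qed

definition precedes_along_axis :: "nat \<Rightarrow> (int ^ 'q::finite) set \<Rightarrow> (int ^ 'q) set \<Rightarrow> bool" where
  "precedes_along_axis r I J \<longleftrightarrow> (\<exists>u c. (\<forall>i\<in>I. i $ u \<le> c) \<and> (\<forall>j\<in>J. c + int r \<le> j $ u))"

text \<open>Along the axis in which \<open>k - i\<close> is largest, each of the pairs \<open>{i, i + j}\<close> and \<open>{k, k + j}\<close> has diameter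
at most \<open>lattice_norm j\<close>, so the gap between them is at least the difference of the norms.\<close>

lemma blocks_separated:
  assumes "0 < lattice_norm (k - i) - lattice_norm j"
  shows "precedes_along_axis (lattice_norm (k - i) - lattice_norm j) {i, i + j} {k, k + j} \<or>
    precedes_along_axis (lattice_norm (k - i) - lattice_norm j) {k, k + j} {i, i + j}"
proof -
  obtain u where u: "\<bar>(k - i) $ u\<bar> = int (lattice_norm (k - i))" using lattice_norm_attained by blast
  have j: "\<bar>j $ u\<bar> \<le> int (lattice_norm j)" using lattice_norm_le_iff by blast
  show ?thesis
  proof (cases "0 \<le> (k - i) $ u")
    case True
    then have "precedes_along_axis (lattice_norm (k - i) - lattice_norm j) {i, i + j} {k, k + j}"
      unfolding precedes_along_axis_def using u j assms
      by (intro exI[of _ u] exI[of _ "i $ u + max 0 (j $ u)"]) (auto simp: of_nat_diff)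
    then show ?thesis ..
  next
    case False
    then have "precedes_along_axis (lattice_norm (k - i) - lattice_norm j) {k, k + j} {i, i + j}"
      unfolding precedes_along_axis_def using u j assms
      by (intro exI[of _ u] exI[of _ "k $ u + max 0 (j $ u)"]) (auto simp: of_nat_diff)
    then show ?thesis ..
  qed
qed

section \<open>Sample sites and lags\<close>

lemma Gam_lag_box: "Gam_lag n j = {i. \<forall>k. i $ k \<in> {max 1 (1 - j $ k)..min (int (n $ k)) (int (n $ k) - j $ k)}}"
proof (rule set_eqI)
  fix i
  have "i \<in> Gam_lag n j \<longleftrightarrow>
      (\<forall>k. (1 \<le> i $ k \<and> i $ k \<le> int (n $ k)) \<and> (1 \<le> i $ k + j $ k \<and> i $ k + j $ k \<le> int (n $ k)))"
    by (auto simp: Gam_lag_def Gam_def)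
  also have "\<dots> \<longleftrightarrow> (\<forall>k. i $ k \<in> {max 1 (1 - j $ k)..min (int (n $ k)) (int (n $ k) - j $ k)})"
    by (intro iff_allI) auto
  finally show "i \<in> Gam_lag n j \<longleftrightarrow>
      i \<in> {i. \<forall>k. i $ k \<in> {max 1 (1 - j $ k)..min (int (n $ k)) (int (n $ k) - j $ k)}}" by simp
qed

lemma finite_Gam_lag: "finite (Gam_lag n (j :: int ^ 'q::finite))"
  unfolding Gam_lag_box by (rule finite_vec_box) auto

text \<open>The set of available pairs is a box with sides \<open>n $ k - \<bar>j $ k\<bar>\<close>, and each side keeps at least half of the
smallest side of the sample.\<close>

lemma card_Gam_lag_ge:
  fixes n :: "nat ^ 'q::finite"
  assumes "2 * lattice_norm j \<le> (MIN k. n $ k)"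
  shows "(real (MIN k. n $ k) / 2) ^ CARD('q) \<le> real (card (Gam_lag n j))"
proof -
  let ?N = "MIN k. n $ k"
  have "real (card (Gam_lag n j)) =
      (\<Prod>k\<in>UNIV. real (card {max 1 (1 - j $ k)..min (int (n $ k)) (int (n $ k) - j $ k)}))"
    unfolding Gam_lag_box by (subst card_vec_box) auto
  moreover have "(\<Prod>k\<in>(UNIV :: 'q set). real ?N / 2) \<le> \<dots>"
  proof (rule prod_mono, rule conjI)
    fix k :: 'q
    have N: "?N \<le> n $ k" by (rule Min_le) auto
    have j: "\<bar>j $ k\<bar> \<le> int (lattice_norm j)" using lattice_norm_le_iff by blast
    have "int ?N - \<bar>j $ k\<bar> \<le> int (card {max 1 (1 - j $ k)..min (int (n $ k)) (int (n $ k) - j $ k)})"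
      unfolding card_atLeastAtMost_int using N by linarith
    moreover have "2 * \<bar>j $ k\<bar> \<le> int ?N" using j assms by linarith
    ultimately have "int ?N \<le> 2 * int (card {max 1 (1 - j $ k)..min (int (n $ k)) (int (n $ k) - j $ k)})"
      by linarith
    then show "real ?N / 2 \<le> real (card {max 1 (1 - j $ k)..min (int (n $ k)) (int (n $ k) - j $ k)})"
      by linarith
  qed simp
  ultimately show ?thesis by simp
qed

lemma finite_lag_window: "finite (lag_window (m :: nat ^ 'q::finite))"
proof -
  have "lag_window m = {j. \<forall>k. j $ k \<in> {- int (m $ k)..int (m $ k)}}"
    unfolding lag_window_def by (auto simp: abs_le_iff minus_le_iff)
  then show ?thesis by (simp only:) (rule finite_vec_box, auto)
qed

lemma lattice_norm_lag_window:
  assumes "j \<in> lag_window m"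
  shows "lattice_norm j \<le> (MAX k. m $ k)"
  unfolding lattice_norm_le_iff
proof
  fix k
  have "m $ k \<le> (MAX k. m $ k)" by (rule Max_ge) auto
  moreover have "\<bar>j $ k\<bar> \<le> int (m $ k)" using assms by (simp add: lag_window_def)
  ultimately show "\<bar>j $ k\<bar> \<le> int (MAX k. m $ k)" by linarith
qed

lemma card_lag_window_le: "card (lag_window (m :: nat ^ 'q::finite)) \<le> (2 * (MAX k. m $ k) + 1) ^ CARD('q)"
proof -
  have "card (lag_window m) \<le> card {d :: int ^ 'q. lattice_norm d \<le> (MAX k. m $ k)}"
    by (rule card_mono[OF finite_lattice_ball]) (auto intro: lattice_norm_lag_window)
  then show ?thesis by (simp add: card_lattice_ball)
qed

lemma eventually_multi_at_top: "eventually (\<lambda>n :: nat ^ 'q::finite. \<forall>k. r \<le> n $ k) multi_at_top"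
proof -
  have "eventually (\<lambda>n :: nat ^ 'q. r \<le> (MIN k. n $ k)) multi_at_top"
    unfolding multi_at_top_def by (rule eventually_filtercomapI[OF eventually_ge_at_top])
  then show ?thesis by (simp add: Min_ge_iff)
qed

section \<open>Summation and matrix entries\<close>

text \<open>Tannery's theorem for truncated and weighted sums along an arbitrary filter: a finite set \<open>T\<close> carries
almost all of the mass of \<open>\<bar>g\<bar>\<close>; on \<open>T\<close> the weights converge, off \<open>T\<close> they are bounded.\<close>

lemma tendsto_weighted_sum_infsum:
  fixes g :: "'j \<Rightarrow> real" and W :: "'n \<Rightarrow> 'j \<Rightarrow> real"
  assumes sm: "(\<lambda>j. \<bar>g j\<bar>) summable_on UNIV"
    and fin: "\<And>n. finite (L n)"
    and ex: "\<And>j. eventually (\<lambda>n. j \<in> L n) F"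
    and lim: "\<And>j. ((\<lambda>n. W n j) \<longlongrightarrow> 1) F"
    and bd: "eventually (\<lambda>n. \<forall>j. \<bar>W n j\<bar> \<le> C) F"
  shows "((\<lambda>n. \<Sum>j\<in>L n. W n j * g j) \<longlongrightarrow> (\<Sum>\<^sub>\<infinity>j. g j)) F"
proof (rule tendstoI)
  fix e :: real assume e: "0 < e"
  \<comment> \<open>The three errors below are \<open>\<delta>\<close>, \<open>\<delta>\<close> and \<open>\<bar>C\<bar> * \<delta>\<close>, which add up to \<open>e\<close>.\<close>
  define \<delta> where "\<delta> = e / (\<bar>C\<bar> + 2)"
  have \<delta>: "0 < \<delta>" "(\<bar>C\<bar> + 2) * \<delta> = e" using e by (auto simp: \<delta>_def)
  let ?S = "\<Sum>\<^sub>\<infinity>j. \<bar>g j\<bar>"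
  have "eventually (\<lambda>T. dist (\<Sum>j\<in>T. \<bar>g j\<bar>) ?S < \<delta>) (finite_subsets_at_top UNIV)"
    using infsum_tendsto[OF sm] \<delta>(1) by (rule tendstoD)
  then obtain T where T: "finite T" "dist (\<Sum>j\<in>T. \<bar>g j\<bar>) ?S < \<delta>"
    unfolding eventually_finite_subsets_at_top by blast
  have tail: "(\<Sum>j\<in>V. \<bar>g j\<bar>) < \<delta>" if V: "finite V" "V \<inter> T = {}" for V
  proof -
    have "(\<Sum>j\<in>V. \<bar>g j\<bar>) + (\<Sum>j\<in>T. \<bar>g j\<bar>) = (\<Sum>j\<in>V \<union> T. \<bar>g j\<bar>)"
      using V T by (simp add: sum.union_disjoint)
    also have "\<dots> \<le> ?S" using V T by (intro finite_sum_le_infsum[OF sm]) auto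
    finally show ?thesis using T(2) by (simp add: dist_real_def abs_less_iff)
  qed
  have g_sm: "g summable_on UNIV" using sm by (subst summable_on_iff_abs_summable_on_real) simp
  have "((\<lambda>U. \<bar>(\<Sum>j\<in>U. g j) - (\<Sum>j\<in>T. g j)\<bar>) \<longlongrightarrow> \<bar>(\<Sum>\<^sub>\<infinity>j. g j) - (\<Sum>j\<in>T. g j)\<bar>) (finite_subsets_at_top UNIV)"
    by (intro tendsto_intros infsum_tendsto g_sm)
  moreover have "eventually (\<lambda>U. \<bar>(\<Sum>j\<in>U. g j) - (\<Sum>j\<in>T. g j)\<bar> \<le> \<delta>) (finite_subsets_at_top UNIV)"
    unfolding eventually_finite_subsets_at_top
  proof (intro exI[of _ T] conjI allI impI)
    fix U assume U: "finite U \<and> T \<subseteq> U \<and> U \<subseteq> UNIV"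
    have "\<bar>(\<Sum>j\<in>U. g j) - (\<Sum>j\<in>T. g j)\<bar> = \<bar>\<Sum>j\<in>U - T. g j\<bar>"
      using U by (subst sum_diff) auto
    also have "\<dots> \<le> (\<Sum>j\<in>U - T. \<bar>g j\<bar>)" by (rule sum_abs)
    also have "\<dots> \<le> \<delta>" using U by (intro less_imp_le tail) auto
    finally show "\<bar>(\<Sum>j\<in>U. g j) - (\<Sum>j\<in>T. g j)\<bar> \<le> \<delta>" .
  qed (use T in auto)
  ultimately have lim_tail: "\<bar>(\<Sum>\<^sub>\<infinity>j. g j) - (\<Sum>j\<in>T. g j)\<bar> \<le> \<delta>"
    by (intro tendsto_upperbound) auto
  have "((\<lambda>n. \<Sum>j\<in>T. W n j * g j) \<longlongrightarrow> (\<Sum>j\<in>T. 1 * g j)) F"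
    by (intro tendsto_intros lim)
  from tendstoD[OF this \<delta>(1)]
  have near: "eventually (\<lambda>n. \<bar>(\<Sum>j\<in>T. W n j * g j) - (\<Sum>j\<in>T. g j)\<bar> < \<delta>) F"
    by (simp add: dist_real_def)
  have sub: "eventually (\<lambda>n. \<forall>j\<in>T. j \<in> L n) F"
    using T ex by (simp add: eventually_ball_finite)
  show "eventually (\<lambda>n. dist (\<Sum>j\<in>L n. W n j * g j) (\<Sum>\<^sub>\<infinity>j. g j) < e) F"
    using near sub bd
  proof eventually_elim
    case (elim n)
    have "(\<Sum>j\<in>L n. W n j * g j) = (\<Sum>j\<in>T. W n j * g j) + (\<Sum>j\<in>L n - T. W n j * g j)"
      using elim(2) fin[of n] by (subst sum.subset_diff[of T "L n"]) auto
    moreover have "\<bar>\<Sum>j\<in>L n - T. W n j * g j\<bar> \<le> \<bar>C\<bar> * \<delta>"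
    proof -
      have "\<bar>\<Sum>j\<in>L n - T. W n j * g j\<bar> \<le> (\<Sum>j\<in>L n - T. \<bar>W n j * g j\<bar>)" by (rule sum_abs)
      also have "\<dots> \<le> (\<Sum>j\<in>L n - T. \<bar>C\<bar> * \<bar>g j\<bar>)"
        unfolding abs_mult using elim(3)
        by (intro sum_mono mult_right_mono) (auto intro: order_trans[OF _ abs_ge_self])
      also have "\<dots> = \<bar>C\<bar> * (\<Sum>j\<in>L n - T. \<bar>g j\<bar>)" by (simp add: sum_distrib_left)
      also have "\<dots> \<le> \<bar>C\<bar> * \<delta>" by (rule mult_left_mono[OF less_imp_le[OF tail]]) (use fin[of n] in auto)
      finally show ?thesis .
    qed
    moreover have "(\<bar>C\<bar> + 2) * \<delta> = \<bar>C\<bar> * \<delta> + 2 * \<delta>" by (simp add: algebra_simps)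
    ultimately show ?case using elim(1) lim_tail \<delta>(2) unfolding dist_real_def by linarith
  qed
qed

lemma summable_on_finite_sum:
  fixes f :: "'i \<Rightarrow> 'j \<Rightarrow> 'b::real_normed_vector"
  assumes "finite I" "\<And>i. i \<in> I \<Longrightarrow> f i summable_on A"
  shows "(\<lambda>x. \<Sum>i\<in>I. f i x) summable_on A"
  using assms by (induction I rule: finite_induct) (auto intro!: summable_on_add)

text \<open>Expanding matrices in this basis reduces integrability and summability of matrix-valued functions to the
same properties of their entries.\<close>

definition unit_matrix :: "'p \<Rightarrow> 'p \<Rightarrow> real ^ 'p::finite ^ 'p" where
  "unit_matrix a b = axis a (axis b 1)"

lemma matrix_decomposition: "A = (\<Sum>a\<in>UNIV. \<Sum>b\<in>UNIV. A $ a $ b *\<^sub>R unit_matrix a b)"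
proof -
  have "(\<Sum>a\<in>UNIV. \<Sum>b\<in>UNIV. A $ a $ b *\<^sub>R unit_matrix a b) $ u $ v = A $ u $ v" for u v
  proof -
    have "(\<Sum>a\<in>UNIV. \<Sum>b\<in>UNIV. A $ a $ b *\<^sub>R unit_matrix a b) $ u $ v
        = (\<Sum>a\<in>UNIV. \<Sum>b\<in>UNIV. A $ a $ b * unit_matrix a b $ u $ v)"
      by simp
    also have "\<dots> = (\<Sum>a\<in>UNIV. \<Sum>b\<in>UNIV. if b = v then (if a = u then A $ a $ b else 0) else 0)"
      by (intro sum.cong refl) (auto simp: unit_matrix_def axis_def)
    also have "\<dots> = A $ u $ v" by (simp add: sum.delta)
    finally show ?thesis .
  qed
  then show ?thesis by (simp add: vec_eq_iff)
qed

lemma bounded_linear_entry: "bounded_linear (\<lambda>A :: real ^ 'p::finite ^ 'p. A $ a $ b)"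
  using bounded_linear_compose[OF bounded_linear_vec_nth bounded_linear_vec_nth] .

lemma max_norm_nonneg: "0 \<le> max_norm A"
  and max_norm_le_sum: "max_norm A \<le> (\<Sum>a\<in>UNIV. \<Sum>b\<in>UNIV. \<bar>A $ a $ b\<bar>)"
proof -
  have eq: "{\<bar>A $ a $ b\<bar> | a b. True} = (\<lambda>(a, b). \<bar>A $ a $ b\<bar>) ` UNIV" by auto
  have "max_norm A \<in> (\<lambda>(a, b). \<bar>A $ a $ b\<bar>) ` UNIV"
    unfolding max_norm_def eq by (rule Max_in) auto
  then obtain a b where ab: "max_norm A = \<bar>A $ a $ b\<bar>" by auto
  then show "0 \<le> max_norm A" by simp
  have "\<bar>A $ a $ b\<bar> \<le> (\<Sum>b\<in>UNIV. \<bar>A $ a $ b\<bar>)" by (rule member_le_sum) auto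
  also have "\<dots> \<le> (\<Sum>a\<in>UNIV. \<Sum>b\<in>UNIV. \<bar>A $ a $ b\<bar>)"
    by (rule member_le_sum[of a _ "\<lambda>a. \<Sum>b\<in>UNIV. \<bar>A $ a $ b\<bar>"]) (auto intro: sum_nonneg)
  finally show "max_norm A \<le> (\<Sum>a\<in>UNIV. \<Sum>b\<in>UNIV. \<bar>A $ a $ b\<bar>)" using ab by simp
qed

section \<open>Covariances of a stationary mixing field\<close>

lemma product_square_le: "((x::real) * y)\<^sup>2 \<le> x ^ 4 + y ^ 4"
proof -
  have "2 * (x\<^sup>2 * y\<^sup>2) \<le> (x\<^sup>2)\<^sup>2 + (y\<^sup>2)\<^sup>2" using sum_squares_bound[of "x\<^sup>2" "y\<^sup>2"] by simp
  then have "2 * (x\<^sup>2 * y\<^sup>2) \<le> x ^ 4 + y ^ 4" by simp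
  moreover have "0 \<le> x\<^sup>2 * y\<^sup>2" by simp
  ultimately show ?thesis unfolding power_mult_distrib by linarith
qed

locale stationary_field = prob_space M for M :: "'w measure" +
  fixes \<xi> :: "int ^ 'q::finite \<Rightarrow> 'w \<Rightarrow> real ^ 'p::finite"
  assumes measurable_field [measurable]: "\<And>i. \<xi> i \<in> borel_measurable M"
    and stationary: "strictly_stationary M \<xi>"
    and centered: "(\<integral>\<omega>. \<xi> 0 \<omega> \<partial>M) = 0"
    and fourth_moment: "\<And>a. integrable M (\<lambda>\<omega>. (\<xi> 0 \<omega> $ a) ^ 4)"
begin

text \<open>Four sites suffice for everything below, because all covariances that occur are between products of two
coordinates of the field.\<close>

lemma shift_invariance:
  fixes F :: "(real ^ 'p) \<times> (real ^ 'p) \<times> (real ^ 'p) \<times> (real ^ 'p) \<Rightarrow> real"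
  assumes [measurable]: "F \<in> borel_measurable borel"
  shows "integrable M (\<lambda>\<omega>. F (\<xi> (i + h) \<omega>, \<xi> (j + h) \<omega>, \<xi> (k + h) \<omega>, \<xi> (l + h) \<omega>)) \<longleftrightarrow>
      integrable M (\<lambda>\<omega>. F (\<xi> i \<omega>, \<xi> j \<omega>, \<xi> k \<omega>, \<xi> l \<omega>))" (is ?int)
    and "expectation (\<lambda>\<omega>. F (\<xi> (i + h) \<omega>, \<xi> (j + h) \<omega>, \<xi> (k + h) \<omega>, \<xi> (l + h) \<omega>)) =
      expectation (\<lambda>\<omega>. F (\<xi> i \<omega>, \<xi> j \<omega>, \<xi> k \<omega>, \<xi> l \<omega>))" (is ?exp)
proof -
  define I where "I = {i, j, k, l}"
  have I [simp]: "i \<in> I" "j \<in> I" "k \<in> I" "l \<in> I" "finite I" by (auto simp: I_def)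
  define G where "G x = F (x i, x j, x k, x l)" for x
  have comp [measurable]: "(\<lambda>x. x t) \<in> borel_measurable (Pi\<^sub>M I (\<lambda>_. borel))" if "t \<in> I" for t
    using that by (rule measurable_component_singleton)
  have G [measurable]: "G \<in> borel_measurable (Pi\<^sub>M I (\<lambda>_. borel))"
    unfolding G_def by (intro measurable_compose[OF _ assms] borel_measurable_Pair comp I)
  have r: "(\<lambda>\<omega>. \<lambda>i\<in>I. \<xi> (s i) \<omega>) \<in> measurable M (Pi\<^sub>M I (\<lambda>_. borel))" for s
    by (intro measurable_restrict) auto
  have d: "distr M (Pi\<^sub>M I (\<lambda>_. borel)) (\<lambda>\<omega>. \<lambda>i\<in>I. \<xi> (i + h) \<omega>) =
      distr M (Pi\<^sub>M I (\<lambda>_. borel)) (\<lambda>\<omega>. \<lambda>i\<in>I. \<xi> i \<omega>)"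
    using stationary by (simp add: strictly_stationary_def)
  show ?int
    using arg_cong[OF d, of "\<lambda>N. integrable N G"]
    unfolding integrable_distr_eq[OF r[of "\<lambda>i. i + h"] G] integrable_distr_eq[OF r[of "\<lambda>i. i"] G]
    by (simp add: G_def)
  show ?exp
    using arg_cong[OF d, of "\<lambda>N. integral\<^sup>L N G"]
    unfolding integral_distr[OF r[of "\<lambda>i. i + h"] G] integral_distr[OF r[of "\<lambda>i. i"] G]
    by (simp add: G_def)
qed

lemma pair_shift_invariance:
  fixes f :: "(real ^ 'p) \<times> (real ^ 'p) \<Rightarrow> real"
  assumes "f \<in> borel_measurable borel"
  shows "integrable M (\<lambda>\<omega>. f (\<xi> (i + h) \<omega>, \<xi> (j + h) \<omega>)) \<longleftrightarrow> integrable M (\<lambda>\<omega>. f (\<xi> i \<omega>, \<xi> j \<omega>))"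
    and "expectation (\<lambda>\<omega>. f (\<xi> (i + h) \<omega>, \<xi> (j + h) \<omega>)) = expectation (\<lambda>\<omega>. f (\<xi> i \<omega>, \<xi> j \<omega>))"
proof -
  have F: "(\<lambda>x. f (fst x, fst (snd x))) \<in> borel_measurable
      (borel :: ((real ^ 'p) \<times> (real ^ 'p) \<times> (real ^ 'p) \<times> (real ^ 'p)) measure)"
    by (intro measurable_compose[OF _ assms] borel_measurable_continuous_onI continuous_intros)
  show "integrable M (\<lambda>\<omega>. f (\<xi> (i + h) \<omega>, \<xi> (j + h) \<omega>)) \<longleftrightarrow> integrable M (\<lambda>\<omega>. f (\<xi> i \<omega>, \<xi> j \<omega>))"
    using shift_invariance(1)[OF F, of i h j i i] by simp
  show "expectation (\<lambda>\<omega>. f (\<xi> (i + h) \<omega>, \<xi> (j + h) \<omega>)) = expectation (\<lambda>\<omega>. f (\<xi> i \<omega>, \<xi> j \<omega>))"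
    using shift_invariance(2)[OF F, of i h j i i] by simp
qed

lemma single_shift_invariance:
  fixes f :: "real ^ 'p \<Rightarrow> real"
  assumes "f \<in> borel_measurable borel"
  shows "integrable M (\<lambda>\<omega>. f (\<xi> i \<omega>)) \<longleftrightarrow> integrable M (\<lambda>\<omega>. f (\<xi> 0 \<omega>))"
    and "expectation (\<lambda>\<omega>. f (\<xi> i \<omega>)) = expectation (\<lambda>\<omega>. f (\<xi> 0 \<omega>))"
proof -
  have F: "(\<lambda>x. f (fst x)) \<in> borel_measurable (borel :: ((real ^ 'p) \<times> (real ^ 'p)) measure)"
    by (intro measurable_compose[OF _ assms] borel_measurable_continuous_onI continuous_intros)
  show "integrable M (\<lambda>\<omega>. f (\<xi> i \<omega>)) \<longleftrightarrow> integrable M (\<lambda>\<omega>. f (\<xi> 0 \<omega>))"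
    using pair_shift_invariance(1)[OF F, of 0 i 0] by simp
  show "expectation (\<lambda>\<omega>. f (\<xi> i \<omega>)) = expectation (\<lambda>\<omega>. f (\<xi> 0 \<omega>))"
    using pair_shift_invariance(2)[OF F, of 0 i 0] by simp
qed

definition field_algebra :: "(int ^ 'q) set \<Rightarrow> 'w measure" where
  "field_algebra I = sigma (space M) {\<xi> i -` B \<inter> space M | i B. i \<in> I \<and> B \<in> sets borel}"

lemma space_field_algebra: "space (field_algebra I) = space M"
  unfolding field_algebra_def by (rule space_measure_of) auto

lemma sets_field_algebra: "sets (field_algebra I) = sigma_generated M \<xi> I"
  unfolding field_algebra_def sigma_generated_def by (rule sets_measure_of) auto

lemma subalgebra_field_algebra: "subalgebra M (field_algebra I)"
  unfolding subalgebra_def sets_field_algebra sigma_generated_def space_field_algebra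
  by (auto intro!: sets.sigma_sets_subset)

lemma measurable_field_algebra:
  assumes "i \<in> I"
  shows "\<xi> i \<in> borel_measurable (field_algebra I)"
proof (rule measurableI)
  fix B :: "(real ^ 'p) set" assume "B \<in> sets borel"
  then show "\<xi> i -` B \<inter> space (field_algebra I) \<in> sets (field_algebra I)"
    using assms unfolding sets_field_algebra sigma_generated_def space_field_algebra
    by (intro sigma_sets.Basic) auto
qed auto

text \<open>Multiplying the bound on the conditional probability by \<open>P(A)\<close> gives a form that is also valid for null
sets \<open>A\<close>.\<close>

lemma phi_bound:
  assumes "1 \<le> r" "A \<in> sigma_minus M \<xi> l 0" "B \<in> sigma_plus M \<xi> l r"
  shows "\<bar>prob (A \<inter> B) - prob A * prob B\<bar> \<le> phi M \<xi> r * prob A"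
proof -
  let ?S = "{\<bar>\<P>(\<omega> in M. \<omega> \<in> B \<bar> \<omega> \<in> A) - measure M B\<bar> | A B.
            A \<in> sigma_minus M \<xi> l 0 \<and> B \<in> sigma_plus M \<xi> l r \<and> measure M A > 0}"
  have cond: "\<P>(\<omega> in M. \<omega> \<in> B \<bar> \<omega> \<in> A) = prob (A \<inter> B) / prob A" if "A \<in> events" "B \<in> events" for A B
  proof -
    have "{\<omega> \<in> space M. \<omega> \<in> B \<and> \<omega> \<in> A} = A \<inter> B" "{\<omega> \<in> space M. \<omega> \<in> A} = A"
      using sets.sets_into_space[OF that(1)] by auto
    then show ?thesis by (simp add: cond_prob_def)
  qed
  have ev: "A \<in> sigma_minus M \<xi> l 0 \<Longrightarrow> A \<in> events" "B \<in> sigma_plus M \<xi> l r \<Longrightarrow> B \<in> events" for A B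
    using subalgebra_field_algebra
    unfolding sigma_minus_def sigma_plus_def sets_field_algebra[symmetric] subalgebra_def by auto
  show ?thesis
  proof (cases "prob A = 0")
    case True
    have "prob (A \<inter> B) \<le> prob A" using ev assms by (intro finite_measure_mono) auto
    then have "prob (A \<inter> B) = 0" using True measure_nonneg[of M "A \<inter> B"] by linarith
    then show ?thesis using True by simp
  next
    case False
    then have pos: "prob A > 0" using measure_nonneg[of M A] by linarith
    have bdd: "bdd_above ?S"
    proof (rule bdd_aboveI[of _ 1])
      fix x assume "x \<in> ?S"
      then obtain A B where AB: "x = \<bar>\<P>(\<omega> in M. \<omega> \<in> B \<bar> \<omega> \<in> A) - measure M B\<bar>"
        "A \<in> sigma_minus M \<xi> l 0" "B \<in> sigma_plus M \<xi> l r" "measure M A > 0" by blast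
      have "prob (A \<inter> B) \<le> prob A" using ev AB by (intro finite_measure_mono) auto
      then have "prob (A \<inter> B) / prob A \<le> 1" "0 \<le> prob (A \<inter> B) / prob A" using AB(4) by auto
      then show "x \<le> 1"
        using prob_le_1[of B] measure_nonneg[of M B] AB(1) unfolding cond[OF ev(1)[OF AB(2)] ev(2)[OF AB(3)]]
        by linarith
    qed
    have "\<bar>prob (A \<inter> B) / prob A - prob B\<bar> \<in> ?S"
      by (rule CollectI, rule exI[of _ A], rule exI[of _ B]) (use assms pos cond ev in auto)
    then have "\<bar>prob (A \<inter> B) / prob A - prob B\<bar> \<le> phi_dir M \<xi> l r"
      unfolding phi_dir_def using bdd by (rule cSup_upper)
    also have "\<dots> \<le> phi M \<xi> r"
      using assms(1) unfolding phi_def by (auto intro!: Max_ge)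
    finally have "\<bar>prob (A \<inter> B) / prob A - prob B\<bar> * prob A \<le> phi M \<xi> r * prob A"
      using pos by (intro mult_right_mono) auto
    moreover have "\<bar>prob (A \<inter> B) / prob A - prob B\<bar> * prob A = \<bar>(prob (A \<inter> B) / prob A - prob B) * prob A\<bar>"
      using pos by (simp add: abs_mult)
    moreover have "(prob (A \<inter> B) / prob A - prob B) * prob A = prob (A \<inter> B) - prob A * prob B"
      using pos by (simp add: field_simps)
    ultimately show ?thesis by simp
  qed
qed

lemma phi_nonneg: "0 \<le> phi M \<xi> r"
proof (cases "r = 0")
  case False
  have "space M \<in> sigma_minus M \<xi> undefined 0" "space M \<in> sigma_plus M \<xi> undefined r"
    unfolding sigma_minus_def sigma_plus_def sigma_generated_def by (auto intro: sigma_sets_top)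
  from phi_bound[OF _ this] False show ?thesis by (simp add: prob_space)
qed (simp add: phi_def)

text \<open>The mixing coefficient compares the half space below level \<open>0\<close> with the one above level \<open>r\<close>. By
stationarity the four sites may be shifted along the axis \<open>u\<close> until the separating level \<open>c\<close> becomes \<open>0\<close>.\<close>

lemma covariance_bound_ordered:
  fixes f g :: "(real ^ 'p) \<times> (real ^ 'p) \<Rightarrow> real"
  assumes f: "f \<in> borel_measurable borel" and g: "g \<in> borel_measurable borel"
    and f2: "integrable M (\<lambda>\<omega>. (f (\<xi> i \<omega>, \<xi> j \<omega>))\<^sup>2)"
    and g2: "integrable M (\<lambda>\<omega>. (g (\<xi> k \<omega>, \<xi> l \<omega>))\<^sup>2)"
    and r: "1 \<le> r" and sep: "i $ u \<le> c" "j $ u \<le> c" "c + int r \<le> k $ u" "c + int r \<le> l $ u"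
  shows "\<bar>expectation (\<lambda>\<omega>. f (\<xi> i \<omega>, \<xi> j \<omega>) * g (\<xi> k \<omega>, \<xi> l \<omega>))
      - expectation (\<lambda>\<omega>. f (\<xi> i \<omega>, \<xi> j \<omega>)) * expectation (\<lambda>\<omega>. g (\<xi> k \<omega>, \<xi> l \<omega>))\<bar>
    \<le> 2 * sqrt (phi M \<xi> r) * sqrt (expectation (\<lambda>\<omega>. (f (\<xi> i \<omega>, \<xi> j \<omega>))\<^sup>2))
        * sqrt (expectation (\<lambda>\<omega>. (g (\<xi> k \<omega>, \<xi> l \<omega>))\<^sup>2))"
proof -
  define h where "h = - axis u c"
  have hu: "(t + h) $ u = t $ u - c" for t by (simp add: h_def)
  let ?X = "\<lambda>\<omega>. f (\<xi> (i + h) \<omega>, \<xi> (j + h) \<omega>)" and ?Y = "\<lambda>\<omega>. g (\<xi> (k + h) \<omega>, \<xi> (l + h) \<omega>)"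
  let ?F = "field_algebra {n. n $ u \<le> 0}" and ?G = "field_algebra {n. int r \<le> n $ u}"
  have f2m: "(\<lambda>x. (f x)\<^sup>2) \<in> borel_measurable borel" and g2m: "(\<lambda>x. (g x)\<^sup>2) \<in> borel_measurable borel"
    using f g by simp_all
  have fg: "(\<lambda>x. f (fst x, fst (snd x)) * g (snd (snd x))) \<in> borel_measurable
      (borel :: ((real ^ 'p) \<times> (real ^ 'p) \<times> (real ^ 'p) \<times> (real ^ 'p)) measure)"
    by (intro borel_measurable_times measurable_compose[OF _ f] measurable_compose[OF _ g]
        borel_measurable_continuous_onI continuous_intros)
  have "\<bar>expectation (\<lambda>\<omega>. ?X \<omega> * ?Y \<omega>) - expectation ?X * expectation ?Y\<bar>
    \<le> 2 * sqrt (phi M \<xi> r) * sqrt (expectation (\<lambda>\<omega>. (?X \<omega>)\<^sup>2)) * sqrt (expectation (\<lambda>\<omega>. (?Y \<omega>)\<^sup>2))"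
  proof (rule mixing_covariance[OF subalgebra_field_algebra subalgebra_field_algebra])
    fix A B assume "A \<in> sets ?F" "B \<in> sets ?G"
    then show "\<bar>prob (A \<inter> B) - prob A * prob B\<bar> \<le> phi M \<xi> r * prob A"
      by (intro phi_bound[OF r, of _ u]) (auto simp: sets_field_algebra sigma_minus_def sigma_plus_def)
  next
    show "?X \<in> borel_measurable ?F"
      using sep hu by (intro measurable_compose[OF _ f] borel_measurable_Pair measurable_field_algebra) auto
    show "?Y \<in> borel_measurable ?G"
      using sep hu by (intro measurable_compose[OF _ g] borel_measurable_Pair measurable_field_algebra) auto
    show "integrable M (\<lambda>\<omega>. (?X \<omega>)\<^sup>2)"
      using f2 pair_shift_invariance(1)[OF f2m, of i h j] by simp
    show "integrable M (\<lambda>\<omega>. (?Y \<omega>)\<^sup>2)"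
      using g2 pair_shift_invariance(1)[OF g2m, of k h l] by simp
  qed
  then show ?thesis
    using shift_invariance(2)[OF fg, of i h j k l]
    by (simp add: pair_shift_invariance(2)[OF f] pair_shift_invariance(2)[OF g]
        pair_shift_invariance(2)[OF f2m] pair_shift_invariance(2)[OF g2m])
qed

text \<open>The bound is symmetric in the two factors although the mixing coefficient is not, so the blocks may be
separated in either order. For \<open>r = 0\<close>, where the mixing coefficient is \<open>1\<close> by convention, the blocks may
even overlap: this is the covariance inequality with both algebras equal to the full one.\<close>

lemma covariance_bound:
  fixes f g :: "(real ^ 'p) \<times> (real ^ 'p) \<Rightarrow> real"
  assumes f: "f \<in> borel_measurable borel" and g: "g \<in> borel_measurable borel"
    and f2: "integrable M (\<lambda>\<omega>. (f (\<xi> i \<omega>, \<xi> j \<omega>))\<^sup>2)"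
    and g2: "integrable M (\<lambda>\<omega>. (g (\<xi> k \<omega>, \<xi> l \<omega>))\<^sup>2)"
    and sep: "0 < r \<Longrightarrow> precedes_along_axis r {i, j} {k, l} \<or> precedes_along_axis r {k, l} {i, j}"
  shows "\<bar>expectation (\<lambda>\<omega>. f (\<xi> i \<omega>, \<xi> j \<omega>) * g (\<xi> k \<omega>, \<xi> l \<omega>))
      - expectation (\<lambda>\<omega>. f (\<xi> i \<omega>, \<xi> j \<omega>)) * expectation (\<lambda>\<omega>. g (\<xi> k \<omega>, \<xi> l \<omega>))\<bar>
    \<le> 2 * sqrt (phi M \<xi> r) * sqrt (expectation (\<lambda>\<omega>. (f (\<xi> i \<omega>, \<xi> j \<omega>))\<^sup>2))
        * sqrt (expectation (\<lambda>\<omega>. (g (\<xi> k \<omega>, \<xi> l \<omega>))\<^sup>2))"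
proof (cases "r = 0")
  case True
  have [measurable]: "(\<lambda>\<omega>. f (\<xi> i \<omega>, \<xi> j \<omega>)) \<in> borel_measurable M"
    by (intro measurable_compose[OF _ f] borel_measurable_Pair measurable_field)
  have [measurable]: "(\<lambda>\<omega>. g (\<xi> k \<omega>, \<xi> l \<omega>)) \<in> borel_measurable M"
    by (intro measurable_compose[OF _ g] borel_measurable_Pair measurable_field)
  have sub: "subalgebra M M" by (simp add: subalgebra_def)
  have phi0: "phi M \<xi> r = 1" using True by (simp add: phi_def)
  \<comment> \<open>The mixing condition with coefficient \<open>1\<close> is trivial.\<close>
  show ?thesis unfolding phi0
  proof (rule mixing_covariance[OF sub sub])
    fix A B assume AB: "A \<in> events" "B \<in> events"
    have "prob (A \<inter> B) \<le> prob A" using AB by (intro finite_measure_mono) auto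
    moreover have "prob A * prob B \<le> prob A * 1" by (intro mult_left_mono) auto
    moreover have "0 \<le> prob (A \<inter> B)" "0 \<le> prob A * prob B" by auto
    ultimately show "\<bar>prob (A \<inter> B) - prob A * prob B\<bar> \<le> 1 * prob A" by linarith
  qed (use f2 g2 in auto)
next
  case False
  then consider "precedes_along_axis r {i, j} {k, l}" | "precedes_along_axis r {k, l} {i, j}" using sep by blast
  then show ?thesis
  proof cases
    case 1
    then show ?thesis
      using False unfolding precedes_along_axis_def by (auto intro: covariance_bound_ordered[OF f g f2 g2])
  next
    case 2
    then obtain u c where "k $ u \<le> c" "l $ u \<le> c" "c + int r \<le> i $ u" "c + int r \<le> j $ u"
      unfolding precedes_along_axis_def by auto
    from covariance_bound_ordered[OF g f g2 f2 _ this] False show ?thesis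
      by (simp add: mult_ac)
  qed
qed

lemma fourth_moment_shift:
  "integrable M (\<lambda>\<omega>. (\<xi> i \<omega> $ a) ^ 4)"
  "expectation (\<lambda>\<omega>. (\<xi> i \<omega> $ a) ^ 4) = expectation (\<lambda>\<omega>. (\<xi> 0 \<omega> $ a) ^ 4)"
proof -
  have m: "(\<lambda>x :: real ^ 'p. (x $ a) ^ 4) \<in> borel_measurable borel"
    by (intro borel_measurable_continuous_onI continuous_intros)
  show "integrable M (\<lambda>\<omega>. (\<xi> i \<omega> $ a) ^ 4)"
    using single_shift_invariance(1)[OF m, of i] fourth_moment by simp
  show "expectation (\<lambda>\<omega>. (\<xi> i \<omega> $ a) ^ 4) = expectation (\<lambda>\<omega>. (\<xi> 0 \<omega> $ a) ^ 4)"
    by (rule single_shift_invariance(2)[OF m])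
qed

lemma measurable_coordinate [measurable]: "(\<lambda>\<omega>. \<xi> i \<omega> $ a) \<in> borel_measurable M"
  by (rule measurable_compose[OF measurable_field]) (intro borel_measurable_continuous_onI continuous_intros)

lemma integrable_coordinate_square: "integrable M (\<lambda>\<omega>. (\<xi> i \<omega> $ a)\<^sup>2)"
  by (rule integrable_of_square) (use fourth_moment_shift(1)[of i a] in auto)

lemma integrable_coordinate: "integrable M (\<lambda>\<omega>. \<xi> i \<omega> $ a)"
  by (rule integrable_of_square) (auto intro: integrable_coordinate_square)

lemma integrable_product: "integrable M (\<lambda>\<omega>. \<xi> i \<omega> $ a * \<xi> j \<omega> $ b)"
  by (intro integrable_mult_of_squares integrable_coordinate_square) auto

lemma
  shows integrable_product_square: "integrable M (\<lambda>\<omega>. (\<xi> i \<omega> $ a * \<xi> j \<omega> $ b)\<^sup>2)"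
    and product_second_moment_le: "expectation (\<lambda>\<omega>. (\<xi> i \<omega> $ a * \<xi> j \<omega> $ b)\<^sup>2)
      \<le> expectation (\<lambda>\<omega>. (\<xi> 0 \<omega> $ a) ^ 4) + expectation (\<lambda>\<omega>. (\<xi> 0 \<omega> $ b) ^ 4)"
proof -
  show *: "integrable M (\<lambda>\<omega>. (\<xi> i \<omega> $ a * \<xi> j \<omega> $ b)\<^sup>2)"
    by (rule Bochner_Integration.integrable_bound[OF
          Bochner_Integration.integrable_add[OF fourth_moment_shift(1)[of i a] fourth_moment_shift(1)[of j b]]])
      (auto intro!: AE_I2 product_square_le order_trans[OF _ abs_ge_self])
  have "expectation (\<lambda>\<omega>. (\<xi> i \<omega> $ a * \<xi> j \<omega> $ b)\<^sup>2)
      \<le> expectation (\<lambda>\<omega>. (\<xi> i \<omega> $ a) ^ 4 + (\<xi> j \<omega> $ b) ^ 4)"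
    by (intro integral_mono * Bochner_Integration.integrable_add fourth_moment_shift(1) product_square_le)
  also have "\<dots> = expectation (\<lambda>\<omega>. (\<xi> 0 \<omega> $ a) ^ 4) + expectation (\<lambda>\<omega>. (\<xi> 0 \<omega> $ b) ^ 4)"
    using fourth_moment_shift(2)[of i a] fourth_moment_shift(2)[of j b] fourth_moment_shift(1)[of i a] fourth_moment_shift(1)[of j b]
    by simp
  finally show "expectation (\<lambda>\<omega>. (\<xi> i \<omega> $ a * \<xi> j \<omega> $ b)\<^sup>2)
      \<le> expectation (\<lambda>\<omega>. (\<xi> 0 \<omega> $ a) ^ 4) + expectation (\<lambda>\<omega>. (\<xi> 0 \<omega> $ b) ^ 4)" .
qed

text \<open>The entries of the autocovariance matrices, as scalar expectations.\<close>

definition lag_cov :: "'p \<Rightarrow> 'p \<Rightarrow> int ^ 'q \<Rightarrow> real" where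
  "lag_cov a b j = expectation (\<lambda>\<omega>. \<xi> 0 \<omega> $ a * \<xi> j \<omega> $ b)"

lemma expectation_product: "expectation (\<lambda>\<omega>. \<xi> i \<omega> $ a * \<xi> (i + j) \<omega> $ b) = lag_cov a b j"
proof -
  have m: "(\<lambda>x :: (real ^ 'p) \<times> (real ^ 'p). fst x $ a * snd x $ b) \<in> borel_measurable borel"
    by (intro borel_measurable_continuous_onI continuous_intros)
  show ?thesis
    using pair_shift_invariance(2)[OF m, of 0 i j] by (simp add: lag_cov_def add.commute)
qed

text \<open>The factors are products of two coordinates, so their variances are controlled by fourth moments of the
field; the distance between the two pairs of sites comes from \<open>blocks_separated\<close>.\<close>

lemma product_covariance_bound:
  obtains K where "0 \<le> K" "\<And>i k j. \<bar>expectation (\<lambda>\<omega>. (\<xi> i \<omega> $ a * \<xi> (i + j) \<omega> $ b - lag_cov a b j) *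
        (\<xi> k \<omega> $ a * \<xi> (k + j) \<omega> $ b - lag_cov a b j))\<bar>
      \<le> K * sqrt (phi M \<xi> (lattice_norm (k - i) - lattice_norm j))"
proof
  define K where "K = expectation (\<lambda>\<omega>. (\<xi> 0 \<omega> $ a) ^ 4) + expectation (\<lambda>\<omega>. (\<xi> 0 \<omega> $ b) ^ 4)"
  have K0: "0 \<le> K" unfolding K_def by (intro add_nonneg_nonneg integral_nonneg) auto
  then show "0 \<le> 2 * K" by simp
  fix i k j :: "int ^ 'q"
  let ?X = "\<lambda>i \<omega>. \<xi> i \<omega> $ a * \<xi> (i + j) \<omega> $ b"
  let ?r = "lattice_norm (k - i) - lattice_norm j"
  have m: "(\<lambda>x :: (real ^ 'p) \<times> (real ^ 'p). fst x $ a * snd x $ b) \<in> borel_measurable borel"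
    by (intro borel_measurable_continuous_onI continuous_intros)
  have iXX: "integrable M (\<lambda>\<omega>. ?X i \<omega> * ?X k \<omega>)"
    by (intro integrable_mult_of_squares integrable_product_square) auto
  have iX: "integrable M (?X i)" "integrable M (?X k)" by (intro integrable_product)+
  have "expectation (\<lambda>\<omega>. (?X i \<omega> - lag_cov a b j) * (?X k \<omega> - lag_cov a b j))
      = expectation (\<lambda>\<omega>. ?X i \<omega> * ?X k \<omega> - lag_cov a b j * ?X i \<omega> - lag_cov a b j * ?X k \<omega> + lag_cov a b j * lag_cov a b j)"
    by (simp add: algebra_simps)
  also have "\<dots> = expectation (\<lambda>\<omega>. ?X i \<omega> * ?X k \<omega>) - lag_cov a b j * lag_cov a b j - lag_cov a b j * lag_cov a b j + lag_cov a b j * lag_cov a b j"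
    using iXX iX expectation_product[of i a j b] expectation_product[of k a j b] by (simp add: prob_space)
  also have "\<dots> = expectation (\<lambda>\<omega>. ?X i \<omega> * ?X k \<omega>) - expectation (?X i) * expectation (?X k)"
    by (simp add: expectation_product)
  finally have "\<bar>expectation (\<lambda>\<omega>. (?X i \<omega> - lag_cov a b j) * (?X k \<omega> - lag_cov a b j))\<bar>
     \<le> 2 * sqrt (phi M \<xi> ?r) * sqrt (expectation (\<lambda>\<omega>. (?X i \<omega>)\<^sup>2)) * sqrt (expectation (\<lambda>\<omega>. (?X k \<omega>)\<^sup>2))"
    using covariance_bound[OF m m, of i "i + j" k "k + j" ?r] blocks_separated[of k i j]
    by (simp add: integrable_product_square)
  also have "\<dots> \<le> 2 * sqrt (phi M \<xi> ?r) * sqrt K * sqrt K"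
    unfolding K_def
    by (intro mult_mono real_sqrt_le_mono product_second_moment_le mult_nonneg_nonneg) (auto simp: phi_nonneg)
  also have "\<dots> = 2 * K * sqrt (phi M \<xi> ?r)"
    using K0 by (simp add: mult.assoc)
  finally show "\<bar>expectation (\<lambda>\<omega>. (?X i \<omega> - lag_cov a b j) * (?X k \<omega> - lag_cov a b j))\<bar> \<le> 2 * K * sqrt (phi M \<xi> ?r)" .
qed

lemma integrable_field: "integrable M (\<xi> i)"
proof -
  have "integrable M (\<lambda>\<omega>. \<Sum>a\<in>UNIV. (\<xi> i \<omega> $ a) *\<^sub>R (axis a 1 :: real ^ 'p))"
    by (intro Bochner_Integration.integrable_sum integrable_scaleR_left integrable_coordinate)
  moreover have "(\<Sum>a\<in>UNIV. (x $ a) *\<^sub>R (axis a 1 :: real ^ 'p)) = x" for x :: "real ^ 'p"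
    by (simp add: vec_eq_iff axis_def if_distrib[of "\<lambda>t. _ * t"] sum.delta cong: if_cong)
  ultimately show ?thesis by simp
qed

text \<open>Integrability of the vector-valued field is what allows the expectation to be taken coordinatewise.\<close>

lemma expectation_coordinate: "expectation (\<lambda>\<omega>. \<xi> i \<omega> $ a) = 0"
proof -
  have m: "(\<lambda>x :: real ^ 'p. x $ a) \<in> borel_measurable borel"
    by (intro borel_measurable_continuous_onI continuous_intros)
  have "expectation (\<lambda>\<omega>. \<xi> 0 \<omega> $ a) = (\<integral>\<omega>. \<xi> 0 \<omega> \<partial>M) $ a"
    by (rule integral_bounded_linear[OF bounded_linear_vec_nth integrable_field])
  then show ?thesis using centered single_shift_invariance(2)[OF m, of i] by simp
qed

text \<open>Since the field is centred, the autocovariance is a covariance of two single coordinates. These are pairs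
of sites at lag \<open>0\<close>, separated by the full norm of \<open>j\<close>.\<close>

lemma lag_cov_bound:
  obtains K where "0 \<le> K" "\<And>j. \<bar>lag_cov a b j\<bar> \<le> K * sqrt (phi M \<xi> (lattice_norm j))"
proof
  define K where "K = sqrt (expectation (\<lambda>\<omega>. (\<xi> 0 \<omega> $ a)\<^sup>2)) * sqrt (expectation (\<lambda>\<omega>. (\<xi> 0 \<omega> $ b)\<^sup>2))"
  show "0 \<le> 2 * K" unfolding K_def by (auto intro!: integral_nonneg)
  fix j :: "int ^ 'q"
  have m: "(\<lambda>x :: (real ^ 'p) \<times> (real ^ 'p). fst x $ a) \<in> borel_measurable borel" for a
    by (intro borel_measurable_continuous_onI continuous_intros)
  have m2: "(\<lambda>x :: real ^ 'p. (x $ b)\<^sup>2) \<in> borel_measurable borel"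
    by (intro borel_measurable_continuous_onI continuous_intros)
  have n0: "lattice_norm (0 :: int ^ 'q) = 0" using lattice_norm_le_iff[of 0 0] by simp
  have "\<bar>lag_cov a b j\<bar> \<le> 2 * sqrt (phi M \<xi> (lattice_norm j)) * sqrt (expectation (\<lambda>\<omega>. (\<xi> 0 \<omega> $ a)\<^sup>2))
      * sqrt (expectation (\<lambda>\<omega>. (\<xi> j \<omega> $ b)\<^sup>2))"
    using covariance_bound[OF m[of a] m[of b], of 0 0 j j "lattice_norm j"] blocks_separated[of j 0 0]
    by (simp add: integrable_coordinate_square expectation_coordinate lag_cov_def n0)
  also have "\<dots> = 2 * K * sqrt (phi M \<xi> (lattice_norm j))"
    unfolding K_def single_shift_invariance(2)[OF m2, of j] by simp
  finally show "\<bar>lag_cov a b j\<bar> \<le> 2 * K * sqrt (phi M \<xi> (lattice_norm j))" .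
qed

end

section \<open>Mean square error of the estimator\<close>

locale mixing_field = stationary_field M \<xi>
  for M :: "'w measure" and \<xi> :: "int ^ 'q::finite \<Rightarrow> 'w \<Rightarrow> real ^ 'p::finite" +
  assumes summable_phi: "summable (\<lambda>r. real (Suc r) ^ (CARD('q) - 1) * sqrt (phi M \<xi> (Suc r)))"
begin

lemma lattice_sum_phi_le:
  obtains C where "0 \<le> C" "\<And>N D. finite D \<Longrightarrow>
    (\<Sum>d\<in>D. sqrt (phi M \<xi> (lattice_norm (d :: int ^ 'q) - N))) \<le> C * real (N + 1) ^ CARD('q)"
proof (rule lattice_sum_le[where 'q = 'q, of "\<lambda>r. sqrt (phi M \<xi> r)"])
  fix C :: real
  assume "0 \<le> C" "\<And>N D. finite D \<Longrightarrow>
    (\<Sum>d\<in>D. sqrt (phi M \<xi> (lattice_norm (d :: int ^ 'q) - N))) \<le> C * real (N + 1) ^ CARD('q)"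
  then show thesis by (rule that)
qed (use summable_phi phi_nonneg in auto)

lemma summable_lag_cov: "(\<lambda>j. \<bar>lag_cov a b j\<bar>) summable_on UNIV"
proof -
  obtain C where C: "0 \<le> C" "\<And>N D. finite D \<Longrightarrow>
    (\<Sum>d\<in>D. sqrt (phi M \<xi> (lattice_norm (d :: int ^ 'q) - N))) \<le> C * real (N + 1) ^ CARD('q)"
    by (rule lattice_sum_phi_le) blast
  obtain K where K: "0 \<le> K" "\<And>j. \<bar>lag_cov a b j\<bar> \<le> K * sqrt (phi M \<xi> (lattice_norm j))"
    by (rule lag_cov_bound[of a b]) blast
  have "(\<Sum>j\<in>D. \<bar>lag_cov a b j\<bar>) \<le> K * C" if "finite D" for D
  proof -
    have "(\<Sum>j\<in>D. \<bar>lag_cov a b j\<bar>) \<le> K * (\<Sum>j\<in>D. sqrt (phi M \<xi> (lattice_norm j)))"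
      unfolding sum_distrib_left by (intro sum_mono K)
    also have "\<dots> \<le> K * C"
      using mult_left_mono[OF C(2)[OF that, of 0] K(1)] by simp
    finally show ?thesis .
  qed
  then show ?thesis
    by (intro nonneg_bdd_above_summable_on bdd_aboveI[of _ "K * C"]) auto
qed

lemma asymp_var_entry: "asymp_var M \<xi> $ a $ b = (\<Sum>\<^sub>\<infinity>k. lag_cov a b k)"
proof -
  have entry: "autocov M \<xi> k $ a $ b = lag_cov a b k" for k a b
  proof -
    have "integrable M (\<lambda>\<omega>. \<Sum>a\<in>UNIV. \<Sum>b\<in>UNIV. (\<xi> 0 \<omega> $ a * \<xi> k \<omega> $ b) *\<^sub>R unit_matrix a b)"
      by (intro Bochner_Integration.integrable_sum integrable_scaleR_left integrable_product)
    moreover have "outer x y = (\<Sum>a\<in>UNIV. \<Sum>b\<in>UNIV. (x $ a * y $ b) *\<^sub>R unit_matrix a b)" for x y :: "real ^ 'p"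
      by (subst matrix_decomposition) (simp add: outer_def)
    ultimately have "integrable M (\<lambda>\<omega>. outer (\<xi> 0 \<omega>) (\<xi> k \<omega>))" by simp
    from integral_bounded_linear[OF bounded_linear_entry this, of a b]
    show ?thesis by (simp add: autocov_def lag_cov_def outer_def)
  qed
  have sm: "lag_cov a b summable_on UNIV" for a b
    using summable_lag_cov[of a b] by (subst summable_on_iff_abs_summable_on_real) simp
  have "(\<lambda>k. \<Sum>a\<in>UNIV. \<Sum>b\<in>UNIV. lag_cov a b k *\<^sub>R (unit_matrix a b :: real ^ 'p ^ 'p)) summable_on UNIV"
    by (intro summable_on_finite_sum summable_on_scaleR_left sm) auto
  moreover have "autocov M \<xi> k = (\<Sum>a\<in>UNIV. \<Sum>b\<in>UNIV. lag_cov a b k *\<^sub>R unit_matrix a b)" for k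
    by (subst matrix_decomposition) (simp add: entry)
  ultimately have "(\<lambda>k. autocov M \<xi> k) summable_on UNIV" by simp
  then have "infsum (\<lambda>k. autocov M \<xi> k $ a $ b) UNIV = infsum (autocov M \<xi>) UNIV $ a $ b"
    using summable_on_bounded_linear[OF bounded_linear_entry]
    by (intro infsum_bounded_linear_strong[OF _ bounded_linear_entry]) blast
  then
  show "asymp_var M \<xi> $ a $ b = (\<Sum>\<^sub>\<infinity>k. lag_cov a b k)"
    by (simp add: asymp_var_def entry)
qed

definition lag_error :: "'p \<Rightarrow> 'p \<Rightarrow> nat ^ 'q \<Rightarrow> int ^ 'q \<Rightarrow> 'w \<Rightarrow> real" where
  "lag_error a b n j \<omega> = autocov_est \<xi> n j \<omega> $ a $ b - lag_cov a b j"

lemma autocov_est_entry: "autocov_est \<xi> n j \<omega> $ a $ b =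
    (\<Sum>i\<in>Gam_lag n j. \<xi> i \<omega> $ a * \<xi> (i + j) \<omega> $ b) / real (card (Gam_lag n j))"
  by (simp add: autocov_est_def outer_def)

lemma measurable_lag_error [measurable]: "lag_error a b n j \<in> borel_measurable M"
  unfolding lag_error_def autocov_est_entry by measurable

lemma integrable_lag_error_square: "integrable M (\<lambda>\<omega>. (lag_error a b n j \<omega>)\<^sup>2)"
proof -
  have "integrable M (\<lambda>\<omega>. (\<Sum>i\<in>Gam_lag n j. \<xi> i \<omega> $ a * \<xi> (i + j) \<omega> $ b)\<^sup>2)"
    by (intro integrable_square_sum integrable_product_square) auto
  then have "integrable M (\<lambda>\<omega>. (autocov_est \<xi> n j \<omega> $ a $ b)\<^sup>2)"
    unfolding autocov_est_entry power_divide by simp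
  moreover from this have "integrable M (\<lambda>\<omega>. autocov_est \<xi> n j \<omega> $ a $ b)"
    by (rule integrable_of_square[rotated]) (simp add: autocov_est_entry)
  ultimately show ?thesis unfolding lag_error_def power2_diff by simp
qed

text \<open>The square of the error is a double sum over sample sites. For each site \<open>i\<close>, the covariances with all
sites \<open>k\<close> sum to a constant times \<open>(lattice_norm j + 1) ^ q\<close>: the sites within distance \<open>lattice_norm j\<close>
of \<open>i\<close> are estimated trivially, the others by mixing. One of the two factors \<open>1 / card\<close> of the squared
average cancels against the sum over \<open>i\<close>.\<close>

lemma autocov_est_mean_square_error:
  obtains C where "0 \<le> C" "\<And>n j. Gam_lag n j \<noteq> {} \<Longrightarrow>
      expectation (\<lambda>\<omega>. (lag_error a b n j \<omega>)\<^sup>2) \<le> C * real (lattice_norm j + 1) ^ CARD('q) / real (card (Gam_lag n j))"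
proof -
  obtain C where C: "0 \<le> C" "\<And>N D. finite D \<Longrightarrow>
    (\<Sum>d\<in>D. sqrt (phi M \<xi> (lattice_norm (d :: int ^ 'q) - N))) \<le> C * real (N + 1) ^ CARD('q)"
    by (rule lattice_sum_phi_le) blast
  obtain K where K: "0 \<le> K" "\<And>i k j. \<bar>expectation (\<lambda>\<omega>. (\<xi> i \<omega> $ a * \<xi> (i + j) \<omega> $ b - lag_cov a b j) *
        (\<xi> k \<omega> $ a * \<xi> (k + j) \<omega> $ b - lag_cov a b j))\<bar>
      \<le> K * sqrt (phi M \<xi> (lattice_norm (k - i) - lattice_norm j))"
    by (rule product_covariance_bound[of a b]) blast
  show thesis
  proof (rule that)
    show "0 \<le> K * C" using K C by simp
    fix n :: "nat ^ 'q" and j :: "int ^ 'q" assume ne: "Gam_lag n j \<noteq> {}"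
    let ?G = "Gam_lag n j"
    let ?c = "real (card ?G)"
    define Z where "Z i \<omega> = \<xi> i \<omega> $ a * \<xi> (i + j) \<omega> $ b - lag_cov a b j" for i \<omega>
    have c: "0 < ?c" using ne finite_Gam_lag[of n j] by (simp add: card_gt_0_iff)
    have [measurable]: "Z i \<in> borel_measurable M" for i unfolding Z_def by measurable
    have Z2: "integrable M (\<lambda>\<omega>. (Z i \<omega>)\<^sup>2)" for i
      unfolding Z_def power2_diff using integrable_product[of i a "i + j" b] integrable_product_square[of i a "i + j" b]
      by simp
    have ZZ: "integrable M (\<lambda>\<omega>. Z i \<omega> * Z k \<omega>)" for i k
      by (intro integrable_mult_of_squares Z2) auto
    have "lag_error a b n j \<omega> = (\<Sum>i\<in>?G. Z i \<omega>) / ?c" for \<omega>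
      using c by (simp add: lag_error_def autocov_est_entry Z_def sum_subtractf field_simps)
    then have "expectation (\<lambda>\<omega>. (lag_error a b n j \<omega>)\<^sup>2)
        = expectation (\<lambda>\<omega>. (\<Sum>i\<in>?G. \<Sum>k\<in>?G. Z i \<omega> * Z k \<omega>) / ?c\<^sup>2)"
      by (simp add: power_divide power2_eq_square sum_product)
    also have "\<dots> = (\<Sum>i\<in>?G. \<Sum>k\<in>?G. expectation (\<lambda>\<omega>. Z i \<omega> * Z k \<omega>)) / ?c\<^sup>2"
      by (simp add: ZZ)
    also have "\<dots> \<le> (\<Sum>i\<in>?G. K * (C * real (lattice_norm j + 1) ^ CARD('q))) / ?c\<^sup>2"
    proof (intro divide_right_mono sum_mono)
      fix i assume "i \<in> ?G"
      have "(\<Sum>k\<in>?G. expectation (\<lambda>\<omega>. Z i \<omega> * Z k \<omega>))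
          \<le> (\<Sum>k\<in>?G. K * sqrt (phi M \<xi> (lattice_norm (k - i) - lattice_norm j)))"
        unfolding Z_def by (intro sum_mono order_trans[OF abs_ge_self K(2)])
      also have "\<dots> = K * (\<Sum>d\<in>(\<lambda>k. k - i) ` ?G. sqrt (phi M \<xi> (lattice_norm d - lattice_norm j)))"
        by (subst sum.reindex) (auto simp: inj_on_def sum_distrib_left)
      also have "\<dots> \<le> K * (C * real (lattice_norm j + 1) ^ CARD('q))"
        by (intro mult_left_mono C K finite_imageI finite_Gam_lag)
      finally show "(\<Sum>k\<in>?G. expectation (\<lambda>\<omega>. Z i \<omega> * Z k \<omega>)) \<le> K * (C * real (lattice_norm j + 1) ^ CARD('q))" .
    qed simp
    also have "\<dots> = K * C * real (lattice_norm j + 1) ^ CARD('q) / ?c"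
      using c by (simp add: power2_eq_square)
    finally show "expectation (\<lambda>\<omega>. (lag_error a b n j \<omega>)\<^sup>2) \<le> K * C * real (lattice_norm j + 1) ^ CARD('q) / ?c" .
  qed
qed

text \<open>Cauchy-Schwarz over the lag window costs the square of the number of lags, of order \<open>M ^ (2 * q)\<close> for the
largest window size \<open>M\<close>, and each lag contributes an error of order \<open>M ^ q / N ^ q\<close> for the smallest
sample size \<open>N\<close>. The product is \<open>(M ^ 3 / N) ^ q\<close>, which is the reason for the cubic rate condition.\<close>

lemma stochastic_error_bound:
  obtains C where "0 \<le> C" "\<And>n m v c. (\<And>j. \<bar>v j\<bar> \<le> c) \<Longrightarrow> 1 \<le> (MAX k. m $ k) \<Longrightarrow>
      2 * (MAX k. m $ k) \<le> (MIN k. n $ k) \<Longrightarrow>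
      expectation (\<lambda>\<omega>. (\<Sum>j\<in>lag_window m. v j * lag_error a b n j \<omega>)\<^sup>2)
        \<le> C * c\<^sup>2 * (real (MAX k. m $ k) ^ 3 / real (MIN k. n $ k)) ^ CARD('q)"
proof -
  obtain C where C: "0 \<le> C" "\<And>n j. Gam_lag n j \<noteq> {} \<Longrightarrow>
      expectation (\<lambda>\<omega>. (lag_error a b n j \<omega>)\<^sup>2) \<le> C * real (lattice_norm j + 1) ^ CARD('q) / real (card (Gam_lag n j))"
    by (rule autocov_est_mean_square_error[of a b]) blast
  show thesis
  proof (rule that)
    show "0 \<le> C * 36 ^ CARD('q)" using C by simp
    fix n m :: "nat ^ 'q" and v :: "int ^ 'q \<Rightarrow> real" and c :: real
    let ?q = "CARD('q)" and ?N = "MIN k. n $ k" and ?M = "MAX k. m $ k" and ?L = "lag_window m"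
    assume v: "\<And>j. \<bar>v j\<bar> \<le> c" and M: "1 \<le> ?M" and MN: "2 * ?M \<le> ?N"
    have N: "0 < real ?N" using M MN by linarith
    \<comment> \<open>Uses \<open>M + 1 \<le> 2 * M\<close> and that at least \<open>(N / 2) ^ q\<close> pairs are available at each lag.\<close>
    define B where "B = C * (2 * real ?M) ^ ?q / (real ?N / 2) ^ ?q"
    have B0: "0 \<le> B" unfolding B_def using C by simp
    have err_le: "expectation (\<lambda>\<omega>. (lag_error a b n j \<omega>)\<^sup>2) \<le> B" if "j \<in> ?L" for j
    proof -
      have j: "lattice_norm j \<le> ?M" by (rule lattice_norm_lag_window[OF that])
      have card: "(real ?N / 2) ^ ?q \<le> real (card (Gam_lag n j))"
        using j MN by (intro card_Gam_lag_ge) linarith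
      have pos: "0 < (real ?N / 2) ^ ?q" using N by simp
      have "Gam_lag n j \<noteq> {}" using card pos by auto
      from C(2)[OF this] have "expectation (\<lambda>\<omega>. (lag_error a b n j \<omega>)\<^sup>2)
          \<le> C * real (lattice_norm j + 1) ^ ?q / real (card (Gam_lag n j))" .
      also have "\<dots> \<le> B"
        unfolding B_def using card pos j M C
        by (intro frac_le mult_left_mono mult_nonneg_nonneg power_mono) auto
      finally show ?thesis .
    qed
    have sq: "(v j)\<^sup>2 \<le> c\<^sup>2" for j using v[of j] by (simp add: abs_le_square_iff[symmetric])
    have i1: "integrable M (\<lambda>\<omega>. (v j * lag_error a b n j \<omega>)\<^sup>2)" for j
      unfolding power_mult_distrib by (intro integrable_mult_right integrable_lag_error_square)
    have "expectation (\<lambda>\<omega>. (\<Sum>j\<in>?L. v j * lag_error a b n j \<omega>)\<^sup>2)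
        \<le> expectation (\<lambda>\<omega>. (\<Sum>j\<in>?L. (v j * lag_error a b n j \<omega>)\<^sup>2) * real (card ?L))"
      by (intro integral_mono integrable_square_sum i1 integrable_mult_left
          Bochner_Integration.integrable_sum sum_squared_le_sum_of_squares) auto
    also have "\<dots> = (\<Sum>j\<in>?L. (v j)\<^sup>2 * expectation (\<lambda>\<omega>. (lag_error a b n j \<omega>)\<^sup>2)) * real (card ?L)"
      by (simp add: power_mult_distrib integrable_lag_error_square)
    also have "\<dots> \<le> (\<Sum>j\<in>?L. c\<^sup>2 * B) * real (card ?L)"
      by (intro mult_right_mono sum_mono mult_mono sq err_le) auto
    also have "\<dots> = c\<^sup>2 * B * (real (card ?L))\<^sup>2" by (simp add: power2_eq_square)
    also have "\<dots> \<le> c\<^sup>2 * B * ((3 * real ?M) ^ ?q)\<^sup>2"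
    proof (intro mult_left_mono power_mono)
      have "real (card ?L) \<le> real ((2 * ?M + 1) ^ ?q)"
        using card_lag_window_le[of m] by (rule of_nat_mono)
      also have "\<dots> = (2 * real ?M + 1) ^ ?q" by (simp add: add.commute)
      also have "\<dots> \<le> (3 * real ?M) ^ ?q" using M by (intro power_mono) auto
      finally show "real (card ?L) \<le> (3 * real ?M) ^ ?q" .
    qed (use B0 in auto)
    also have "\<dots> = C * 36 ^ ?q * c\<^sup>2 * (real ?M ^ 3 / real ?N) ^ ?q"
    proof -
      have "(2 * x) ^ ?q / (y / 2) ^ ?q * ((3 * x) ^ ?q)\<^sup>2 = 36 ^ ?q * (x ^ 3 / y) ^ ?q" for x y :: real
      proof -
        have "((3 * x) ^ ?q)\<^sup>2 = ((3 * x)\<^sup>2) ^ ?q" by (simp only: power_mult[symmetric] mult.commute)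
        then have "(2 * x) ^ ?q / (y / 2) ^ ?q * ((3 * x) ^ ?q)\<^sup>2 = ((2 * x) / (y / 2) * (3 * x)\<^sup>2) ^ ?q"
          by (simp only: power_mult_distrib power_divide)
        also have "(2 * x) / (y / 2) * (3 * x)\<^sup>2 = 36 * (x ^ 3 / y)"
          by (simp add: power2_eq_square power3_eq_cube)
        also have "\<dots> ^ ?q = 36 ^ ?q * (x ^ 3 / y) ^ ?q" by (rule power_mult_distrib)
        finally show ?thesis .
      qed
      note scale = this[of "real ?M" "real ?N"]
      have "c\<^sup>2 * B * ((3 * real ?M) ^ ?q)\<^sup>2
          = C * c\<^sup>2 * ((2 * real ?M) ^ ?q / (real ?N / 2) ^ ?q * ((3 * real ?M) ^ ?q)\<^sup>2)"
        unfolding B_def by (simp only: times_divide_eq_left times_divide_eq_right mult_ac)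
      also have "\<dots> = C * c\<^sup>2 * (36 ^ ?q * (real ?M ^ 3 / real ?N) ^ ?q)"
        by (simp only: scale)
      finally show ?thesis by (simp only: mult_ac)
    qed
    finally show "expectation (\<lambda>\<omega>. (\<Sum>j\<in>?L. v j * lag_error a b n j \<omega>)\<^sup>2)
        \<le> C * 36 ^ ?q * c\<^sup>2 * (real ?M ^ 3 / real ?N) ^ ?q" .
  qed
qed

text \<open>The lag errors are centred at the true autocovariances, so the remaining term is deterministic.\<close>

lemma var_est_error:
  "(var_est w \<xi> k n \<omega> - asymp_var M \<xi>) $ a $ b =
    (\<Sum>j\<in>lag_window k. w k j * lag_error a b n j \<omega>) +
    ((\<Sum>j\<in>lag_window k. w k j * lag_cov a b j) - (\<Sum>\<^sub>\<infinity>j. lag_cov a b j))"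
  by (simp add: var_est_def lag_error_def asymp_var_entry algebra_simps sum_subtractf sum.distrib)

lemma integrable_var_est_error_square:
  "integrable M (\<lambda>\<omega>. ((var_est w \<xi> k n \<omega> - asymp_var M \<xi>) $ a $ b)\<^sup>2)"
proof -
  have N2: "integrable M (\<lambda>\<omega>. (\<Sum>j\<in>lag_window k. w k j * lag_error a b n j \<omega>)\<^sup>2)"
    by (intro integrable_square_sum) (auto simp: power_mult_distrib integrable_lag_error_square)
  moreover have "integrable M (\<lambda>\<omega>. \<Sum>j\<in>lag_window k. w k j * lag_error a b n j \<omega>)"
    by (rule integrable_of_square[OF _ N2]) measurable
  ultimately show ?thesis unfolding var_est_error power2_sum by simp
qed

text \<open>The stochastic part vanishes by the rate condition, the bias by absolute summability of the
autocovariances together with the convergence and boundedness of the weights.\<close>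

lemma var_est_mean_square_consistent:
  assumes W1: "\<And>j. ((\<lambda>k. w k j) \<longlongrightarrow> 1) multi_at_top"
    and W2: "\<And>k j. (\<And>a. 1 \<le> k $ a) \<Longrightarrow> \<bar>w k j\<bar> \<le> Cw"
    and m: "filterlim m multi_at_top multi_at_top"
    and rate: "((\<lambda>n. real (MAX a. m n $ a) ^ 3 / real (MIN a. n $ a)) \<longlongrightarrow> 0) multi_at_top"
  shows "((\<lambda>n :: nat ^ 'q. expectation (\<lambda>\<omega>. ((var_est w \<xi> (m n) n \<omega> - asymp_var M \<xi>) $ a $ b)\<^sup>2)) \<longlongrightarrow> 0) multi_at_top"
proof -
  let ?q = "CARD('q)"
  let ?\<rho> = "\<lambda>n. real (MAX a. m n $ a) ^ 3 / real (MIN a. n $ a)"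
  let ?bias = "\<lambda>n. (\<Sum>j\<in>lag_window (m n). w (m n) j * lag_cov a b j) - (\<Sum>\<^sub>\<infinity>j. lag_cov a b j)"
  let ?noise = "\<lambda>n \<omega>. \<Sum>j\<in>lag_window (m n). w (m n) j * lag_error a b n j \<omega>"
  obtain C where C: "0 \<le> C" "\<And>n m v c. (\<And>j. \<bar>v j\<bar> \<le> c) \<Longrightarrow> 1 \<le> (MAX k. m $ k) \<Longrightarrow>
      2 * (MAX k. m $ k) \<le> (MIN k. n $ k) \<Longrightarrow>
      expectation (\<lambda>\<omega>. (\<Sum>j\<in>lag_window m. v j * lag_error a b n j \<omega>)\<^sup>2)
        \<le> C * c\<^sup>2 * (real (MAX k. m $ k) ^ 3 / real (MIN k. n $ k)) ^ CARD('q)"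
    by (rule stochastic_error_bound[of a b]) blast
  have m_ge: "eventually (\<lambda>n. \<forall>k. r \<le> m n $ k) multi_at_top" for r
    using eventually_multi_at_top[of r] m by (auto simp: filterlim_iff)
  have w_bd: "eventually (\<lambda>n. \<forall>j. \<bar>w (m n) j\<bar> \<le> Cw) multi_at_top"
    using m_ge[of 1] by eventually_elim (auto intro: W2)
  have bias: "(?bias \<longlongrightarrow> 0) multi_at_top"
  proof -
    have "((\<lambda>n. \<Sum>j\<in>lag_window (m n). w (m n) j * lag_cov a b j) \<longlongrightarrow> (\<Sum>\<^sub>\<infinity>j. lag_cov a b j)) multi_at_top"
    proof (rule tendsto_weighted_sum_infsum[OF summable_lag_cov finite_lag_window _ _ w_bd])
      fix j
      show "eventually (\<lambda>n. j \<in> lag_window (m n)) multi_at_top"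
        using m_ge[of "lattice_norm j"]
      proof eventually_elim
        case (elim n)
        have "\<bar>j $ k\<bar> \<le> int (m n $ k)" for k
          using elim lattice_norm_le_iff[of j "lattice_norm j"] by (metis order.refl order_trans of_nat_mono)
        then show ?case by (simp add: lag_window_def)
      qed
      show "((\<lambda>n. w (m n) j) \<longlongrightarrow> 1) multi_at_top"
        by (rule filterlim_compose[OF W1 m])
    qed
    from tendsto_diff[OF this tendsto_const[of "\<Sum>\<^sub>\<infinity>j. lag_cov a b j"]] show ?thesis by simp
  qed
  have small: "eventually (\<lambda>n. ?\<rho> n < 1 / 2) multi_at_top"
    using order_tendstoD(2)[OF rate, of "1 / 2"] by simp
  have bound: "eventually (\<lambda>n. expectation (\<lambda>\<omega>. ((var_est w \<xi> (m n) n \<omega> - asymp_var M \<xi>) $ a $ b)\<^sup>2)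
      \<le> 2 * (C * Cw\<^sup>2 * ?\<rho> n ^ ?q) + 2 * (?bias n)\<^sup>2) multi_at_top"
    using small m_ge[of 1] w_bd eventually_multi_at_top[of 1]
  proof eventually_elim
    case (elim n)
    let ?M = "MAX k. m n $ k" and ?N = "MIN k. n $ k"
    have M: "1 \<le> ?M" using elim(2) by (subst Max_ge_iff) auto
    have N: "1 \<le> ?N" using elim(4) by (subst Min_ge_iff) auto
    \<comment> \<open>Since \<open>M \<le> M ^ 3\<close>, the rate condition also keeps the window below half of the sample.\<close>
    have "real ?M ^ 1 \<le> real ?M ^ 3" using M by (intro power_increasing) auto
    moreover have "2 * real ?M ^ 3 < real ?N"
    proof -
      have "0 < real ?N" using N by linarith
      then have "real ?M ^ 3 < 1 / 2 * real ?N" using elim(1) by (simp only: pos_divide_less_eq)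
      then show ?thesis by linarith
    qed
    ultimately have "2 * real ?M \<le> real ?N" unfolding power_one_right by linarith
    then have MN: "2 * ?M \<le> ?N" by linarith
    have N2: "integrable M (\<lambda>\<omega>. (?noise n \<omega>)\<^sup>2)"
      by (intro integrable_square_sum) (auto simp: power_mult_distrib integrable_lag_error_square)
    have "expectation (\<lambda>\<omega>. ((var_est w \<xi> (m n) n \<omega> - asymp_var M \<xi>) $ a $ b)\<^sup>2)
        \<le> expectation (\<lambda>\<omega>. 2 * (?noise n \<omega>)\<^sup>2 + 2 * (?bias n)\<^sup>2)"
    proof (intro integral_mono integrable_var_est_error_square)
      show "integrable M (\<lambda>\<omega>. 2 * (?noise n \<omega>)\<^sup>2 + 2 * (?bias n)\<^sup>2)" using N2 by simp
      have "(x + y)\<^sup>2 \<le> 2 * x\<^sup>2 + 2 * y\<^sup>2" for x y :: real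
        using sum_squares_bound[of x y] by (simp add: power2_sum)
      then show "((var_est w \<xi> (m n) n \<omega> - asymp_var M \<xi>) $ a $ b)\<^sup>2 \<le> 2 * (?noise n \<omega>)\<^sup>2 + 2 * (?bias n)\<^sup>2" for \<omega>
        unfolding var_est_error .
    qed
    also have "\<dots> = 2 * expectation (\<lambda>\<omega>. (?noise n \<omega>)\<^sup>2) + 2 * (?bias n)\<^sup>2"
      using N2 by (simp add: prob_space)
    also have "\<dots> \<le> 2 * (C * Cw\<^sup>2 * ?\<rho> n ^ ?q) + 2 * (?bias n)\<^sup>2"
      using C(2)[of "w (m n)" Cw "m n" n] elim(3) M MN by simp
    finally show ?case .
  qed
  have "((\<lambda>n. 2 * (C * Cw\<^sup>2 * ?\<rho> n ^ ?q) + 2 * (?bias n)\<^sup>2) \<longlongrightarrow> 2 * (C * Cw\<^sup>2 * 0 ^ ?q) + 2 * 0\<^sup>2) multi_at_top"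
    by (intro tendsto_intros rate bias)
  then have "((\<lambda>n. 2 * (C * Cw\<^sup>2 * ?\<rho> n ^ ?q) + 2 * (?bias n)\<^sup>2) \<longlongrightarrow> 0) multi_at_top"
    by (simp add: zero_power)
  then show ?thesis
    by (rule tendsto_sandwich[OF _ bound tendsto_const, rotated]) (auto intro!: always_eventually integral_nonneg)
qed

end

theorem theorem2p2:
  fixes M :: "'w measure"
    and \<xi> :: "int ^ 'q::finite \<Rightarrow> 'w \<Rightarrow> real ^ 'p::finite"
    and w :: "nat ^ 'q \<Rightarrow> int ^ 'q \<Rightarrow> real"
    and m :: "nat ^ 'q \<Rightarrow> nat ^ 'q"
    and Cw :: real
  assumes "prob_space M"
    and "\<And>i. \<xi> i \<in> borel_measurable M"
    and "strictly_stationary M \<xi>"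
    and "phi_mixing M \<xi>"
    and "(\<integral>\<omega>. \<xi> 0 \<omega> \<partial>M) = 0"
    and "\<And>a. integrable M (\<lambda>\<omega>. (\<xi> 0 \<omega> $ a) ^ 4)"
    and "summable (\<lambda>r. real (Suc r) ^ (CARD('q) - 1) * sqrt (phi M \<xi> (Suc r)))"
    and W1: "\<And>j. ((\<lambda>k. w k j) \<longlongrightarrow> 1) multi_at_top"
    and W2: "\<And>k j. (\<And>a. 1 \<le> k $ a) \<Longrightarrow> \<bar>w k j\<bar> \<le> Cw"
    and "filterlim m multi_at_top multi_at_top"
    and "((\<lambda>n. real (MAX a. m n $ a) ^ 3 / real (MIN a. n $ a)) \<longlongrightarrow> 0) multi_at_top"
  shows "(CARD('p) = 1 \<longrightarrow>
            (\<forall>a. ((\<lambda>n. \<integral>\<omega>. ((var_est w \<xi> (m n) n \<omega> - asymp_var M \<xi>) $ a $ a)\<^sup>2 \<partial>M)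
                    \<longlongrightarrow> 0) multi_at_top)) \<and>
         (CARD('p) > 1 \<longrightarrow>
            ((\<lambda>n. \<integral>\<omega>. max_norm (var_est w \<xi> (m n) n \<omega> - asymp_var M \<xi>) \<partial>M)
               \<longlongrightarrow> 0) multi_at_top)"
proof -
  interpret prob_space M by fact
  interpret mixing_field M \<xi>
    by unfold_locales (use assms in auto)
  let ?E = "\<lambda>n \<omega>. var_est w \<xi> (m n) n \<omega> - asymp_var M \<xi>"
  have mse: "((\<lambda>n. expectation (\<lambda>\<omega>. (?E n \<omega> $ a $ b)\<^sup>2)) \<longlongrightarrow> 0) multi_at_top" for a b
    using W1 W2 assms(10,11) by (rule var_est_mean_square_consistent)
  have meas: "(\<lambda>\<omega>. ?E n \<omega> $ a $ b) \<in> borel_measurable M" for n a b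
    unfolding var_est_error by measurable
  have abs: "integrable M (\<lambda>\<omega>. \<bar>?E n \<omega> $ a $ b\<bar>)" for n a b
    using integrable_of_square[OF meas integrable_var_est_error_square] by (rule integrable_abs)
  have bound: "expectation (\<lambda>\<omega>. max_norm (?E n \<omega>))
      \<le> (\<Sum>a\<in>UNIV. \<Sum>b\<in>UNIV. sqrt (expectation (\<lambda>\<omega>. (?E n \<omega> $ a $ b)\<^sup>2)))" for n
  proof -
    have "expectation (\<lambda>\<omega>. max_norm (?E n \<omega>))
        \<le> expectation (\<lambda>\<omega>. \<Sum>a\<in>UNIV. \<Sum>b\<in>UNIV. \<bar>?E n \<omega> $ a $ b\<bar>)"
      by (rule integral_mono')
        (auto intro!: Bochner_Integration.integrable_sum abs max_norm_le_sum sum_nonneg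
          simp del: vector_minus_component)
    also have "\<dots> = (\<Sum>a\<in>UNIV. \<Sum>b\<in>UNIV. expectation (\<lambda>\<omega>. \<bar>?E n \<omega> $ a $ b\<bar>))"
      by (subst Bochner_Integration.integral_sum,
          intro Bochner_Integration.integrable_sum abs,
          intro sum.cong refl Bochner_Integration.integral_sum abs)
    also have "\<dots> \<le> (\<Sum>a\<in>UNIV. \<Sum>b\<in>UNIV. sqrt (expectation (\<lambda>\<omega>. (?E n \<omega> $ a $ b)\<^sup>2)))"
      by (intro sum_mono expectation_abs_le meas integrable_var_est_error_square)
    finally show ?thesis .
  qed
  have "((\<lambda>n. \<Sum>a\<in>UNIV. \<Sum>b\<in>UNIV. sqrt (expectation (\<lambda>\<omega>. (?E n \<omega> $ a $ b)\<^sup>2)))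
      \<longlongrightarrow> (\<Sum>a\<in>(UNIV :: 'p set). \<Sum>b\<in>(UNIV :: 'p set). sqrt 0)) multi_at_top"
    by (intro tendsto_intros mse)
  then have upper: "((\<lambda>n. \<Sum>a\<in>UNIV. \<Sum>b\<in>UNIV. sqrt (expectation (\<lambda>\<omega>. (?E n \<omega> $ a $ b)\<^sup>2))) \<longlongrightarrow> 0) multi_at_top"
    by simp
  have nonneg: "eventually (\<lambda>n. 0 \<le> expectation (\<lambda>\<omega>. max_norm (?E n \<omega>))) multi_at_top"
    by (intro always_eventually allI Bochner_Integration.integral_nonneg max_norm_nonneg)
  have below: "eventually (\<lambda>n. expectation (\<lambda>\<omega>. max_norm (?E n \<omega>))
      \<le> (\<Sum>a\<in>UNIV. \<Sum>b\<in>UNIV. sqrt (expectation (\<lambda>\<omega>. (?E n \<omega> $ a $ b)\<^sup>2)))) multi_at_top"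
    by (intro always_eventually allI bound)
  have "((\<lambda>n. expectation (\<lambda>\<omega>. max_norm (?E n \<omega>))) \<longlongrightarrow> 0) multi_at_top"
    by (rule tendsto_sandwich[OF nonneg below tendsto_const upper])
  then show ?thesis using mse by blast
qed

end
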